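(* Put $p\geq 3$, $\lambda=\lambda_p=2\cos(\pi/p)$ and $U=ST$. Suppose that $\alpha$ is a hyperbolic fixed point of $G_p$, with Hecke conjugate $\alpha'$. Then $\alpha$ is $G_p$-reduced and its $\lambda$-continued fraction has exactly $k$ leading ones if and only if $k$ is the smallest nonnegative integer such that $$0<\alpha'<U^{k+2}(0)<\alpha<U^{k+1}(0).$$
   Context: Let $S=\begin{pmatrix}1&\lambda\\0&1\end{pmatrix}$, $T=\begin{pmatrix}0&-1\\1&0\end{pmatrix}$, and $G_p=\langle S,T\rangle/\{\pm I\}$ acting on $\mathbb{R}\cup\{\infty\}$ by linear fractional transformations. A hyperbolic element has $|{\rm trace}|>2$ and two distinct real fixed points; a hyperbolic fixed point is a fixed point of a hyperbolic element of $G_p$, and its Hecke conjugate is the other fixed point of the elements of its stabilizer. The $\lambda$-continued fraction of a real $\alpha$: $\alpha_0=\alpha$, $r_j=\lfloor\alpha_j/\lambda\rfloor+1$, $\alpha_{j+1}=\frac{1}{r_j\lambda-\alpha_j}$, giving $\alpha=r_0\lambda-\cfrac{1}{r_1\lambda-\cfrac{1}{r_2\lambda-\cdots}}=[r_0;r_1,\dots]$. It has exactly $k$ leading ones if $r_0=\cdots=r_{k-1}=1$ and $r_k\neq1$. A real $\alpha$ is $G_p$-reduced if its $\lambda$-continued fraction is purely periodic ($r_{j+m}=r_j$ for all $j\ge0$, some $m\ge1$) with period other than $(2,1,\dots,1)$ with $p-3$ ones. *)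

theory Defs
  imports "HOL-Analysis.Analysis"
begin

definition mk2 :: "real \<Rightarrow> real \<Rightarrow> real \<Rightarrow> real \<Rightarrow> real^2^2" where
  "mk2 a b c d = (\<chi> i j. if i = 1 then (if j = 1 then a else b) else (if j = 1 then c else d))"

definition lam :: "nat \<Rightarrow> real" where
  "lam p = 2 * cos (pi / real p)"

definition Smat :: "real \<Rightarrow> real^2^2" where "Smat l = mk2 1 l 0 1"
definition Sinv :: "real \<Rightarrow> real^2^2" where "Sinv l = mk2 1 (-l) 0 1"
definition Tmat :: "real^2^2" where "Tmat = mk2 0 (-1) 1 0"
definition Tinv :: "real^2^2" where "Tinv = mk2 0 1 (-1) 0"
definition Umat :: "real \<Rightarrow> real^2^2" where "Umat l = Smat l ** Tmat"

text \<open>The matrix group generated by S and T (all words in S, S^-1, T, T^-1).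
  Working in SL(2,R) rather than modulo +-I is harmless: trace up to sign and the
  linear fractional action are invariant under M -> -M.\<close>
inductive_set Gp :: "real \<Rightarrow> (real^2^2) set" for l where
  id: "mat 1 \<in> Gp l"
| mS: "g \<in> Gp l \<Longrightarrow> g ** Smat l \<in> Gp l"
| mSi: "g \<in> Gp l \<Longrightarrow> g ** Sinv l \<in> Gp l"
| mT: "g \<in> Gp l \<Longrightarrow> g ** Tmat \<in> Gp l"
| mTi: "g \<in> Gp l \<Longrightarrow> g ** Tinv \<in> Gp l"

text \<open>Linear fractional action on R \<union> {\<infinity>}, modelled by ereal; both -\<infinity> and \<infinity>
  stand for the single point \<infinity> (the action always returns \<infinity> as PInf).\<close>
definition mob :: "real^2^2 \<Rightarrow> ereal \<Rightarrow> ereal" where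
  "mob M z = (let a = M$1$1; b = M$1$2; c = M$2$1; d = M$2$2 in
     (case z of
        ereal x \<Rightarrow> (if c * x + d = 0 then \<infinity> else ereal ((a * x + b) / (c * x + d)))
      | _ \<Rightarrow> (if c = 0 then \<infinity> else ereal (a / c))))"

text \<open>Points of R \<union> {\<infinity>}: we exclude MInf as a representative.\<close>
definition is_pt :: "ereal \<Rightarrow> bool" where "is_pt z \<longleftrightarrow> z \<noteq> - \<infinity>"

definition hyperbolic :: "real^2^2 \<Rightarrow> bool" where
  "hyperbolic M \<longleftrightarrow> \<bar>M$1$1 + M$2$2\<bar> > 2 \<and>
     (\<exists>x y::ereal. is_pt x \<and> is_pt y \<and> x \<noteq> y \<and> mob M x = x \<and> mob M y = y)"

definition hecke_pair :: "nat \<Rightarrow> real \<Rightarrow> ereal \<Rightarrow> bool" where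
  "hecke_pair p \<alpha> \<beta> \<longleftrightarrow> is_pt \<beta> \<and> \<beta> \<noteq> ereal \<alpha> \<and>
     (\<exists>g \<in> Gp (lam p). hyperbolic g \<and> mob g (ereal \<alpha>) = ereal \<alpha> \<and> mob g \<beta> = \<beta>)"

fun cf_alpha :: "real \<Rightarrow> real \<Rightarrow> nat \<Rightarrow> real" where
  "cf_alpha l \<alpha> 0 = \<alpha>"
| "cf_alpha l \<alpha> (Suc j) =
     1 / (of_int (\<lfloor>cf_alpha l \<alpha> j / l\<rfloor> + 1) * l - cf_alpha l \<alpha> j)"

definition cf_digit :: "real \<Rightarrow> real \<Rightarrow> nat \<Rightarrow> int" where
  "cf_digit l \<alpha> j = \<lfloor>cf_alpha l \<alpha> j / l\<rfloor> + 1"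

definition leading_ones :: "real \<Rightarrow> real \<Rightarrow> nat \<Rightarrow> bool" where
  "leading_ones l \<alpha> k \<longleftrightarrow> (\<forall>j<k. cf_digit l \<alpha> j = 1) \<and> cf_digit l \<alpha> k \<noteq> 1"

definition Gp_reduced :: "nat \<Rightarrow> real \<Rightarrow> bool" where
  "Gp_reduced p \<alpha> \<longleftrightarrow>
     (\<exists>m\<ge>1. \<forall>j. cf_digit (lam p) \<alpha> (j + m) = cf_digit (lam p) \<alpha> j) \<and>
     \<not> (\<forall>j. cf_digit (lam p) \<alpha> j = (if j mod (p - 2) = 0 then 2 else 1))"

definition Ucond :: "nat \<Rightarrow> real \<Rightarrow> ereal \<Rightarrow> nat \<Rightarrow> bool" where
  "Ucond p \<alpha> \<beta> k \<longleftrightarrow>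
     0 < \<beta> \<and> \<beta> < (mob (Umat (lam p)) ^^ (k + 2)) 0 \<and>
     (mob (Umat (lam p)) ^^ (k + 2)) 0 < ereal \<alpha> \<and>
     ereal \<alpha> < (mob (Umat (lam p)) ^^ (k + 1)) 0"

end

(* The group acts on lifts of points to the plane, and a step of the continued fraction is
   multiplication by an inverse of a word S^r T. For every g in the group the orbits of a lift v and
   of g v under this step meet up to sign, for the whole matrix and not only for the point. If g is
   hyperbolic and fixes alpha, then v and g v are proportional with a factor other than 1 and -1, so
   the orbit of the pair (alpha, alpha') is eventually periodic, with multipliers mu and 1 / mu on
   the two lifts.

   The condition on alpha' is preserved by a step, and under it the digit of a step can be recovered
   from the image of alpha'; so eventual periodicity becomes pure periodicity. Conversely, a periodic
   solution of the recurrence that never satisfies the condition has a positive quantity that does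
   not increase, hence a multiplier in (0, 1]. This applies to the lift of alpha, so mu < 1 and the
   lift of alpha', having multiplier 1 / mu > 1, must satisfy the condition. *)

theory Submission
  imports Defs
begin

section \<open>The numbers sin (i pi / p) / sin (pi / p)\<close>

text \<open>These are Chebyshev values at half of lambda: for \<open>i >= 1\<close> the matrix
  \<open>U^i\<close> has the rows \<open>(s (i+1), - s i)\<close> and
  \<open>(s i, - s (i-1))\<close>.\<close>

definition sn :: "nat \<Rightarrow> nat \<Rightarrow> real" where
  "sn p i = sin (real i * (pi / real p)) / sin (pi / real p)"

locale hecke =
  fixes p :: nat
  assumes p3: "p \<ge> 3"
begin

abbreviation l :: real where "l \<equiv> lam p"
abbreviation s :: "nat \<Rightarrow> real" where "s \<equiv> sn p"

lemma sin_pos: "sin (pi / real p) > 0"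
  using p3 by (intro sin_gt_zero) (auto simp: field_simps)

lemma s_0 [simp]: "s 0 = 0"
  by (simp add: sn_def)

lemma s_1 [simp]: "s (Suc 0) = 1"
  using sin_pos by (simp add: sn_def)

lemma s_rec: "s (Suc (Suc i)) = l * s (Suc i) - s i"
proof -
  define t where "t = pi / real p"
  have "sin (real (Suc (Suc i)) * t) + sin (real i * t) = 2 * cos t * sin (real (Suc i) * t)"
    using sin_plus_sin [of "real (Suc (Suc i)) * t" "real i * t"]
    by (simp add: algebra_simps add_divide_distrib)
  then show ?thesis
    using sin_pos by (simp add: sn_def lam_def t_def [symmetric] field_simps)
qed

lemma s_reflect:
  assumes "i \<le> p"
  shows "s (p - i) = s i"
proof -
  have "real (p - i) * (pi / real p) = pi - real i * (pi / real p)"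
    using assms p3 by (simp add: of_nat_diff field_simps)
  then show ?thesis by (simp add: sn_def)
qed

text \<open>Sum to product gives a sine and a cosine, both nonnegative because
  \<open>(i + 1) * t <= pi\<close>. The bound 1, not mere positivity, later makes
  \<open>\<Phi>\<close> nonincreasing.\<close>

lemma s_ge_1:
  assumes "1 \<le> i" "i < p"
  shows "s i \<ge> 1"
proof -
  define t where "t = pi / real p"
  have t: "0 < t" "real p * t = pi" using p3 by (auto simp: t_def)
  have ip: "real (i + 1) * t \<le> pi"
    using assms t by (metis Suc_eq_plus1 Suc_leI less_eq_real_def mult_right_mono of_nat_le_iff)
  have "sin (real i * t) - sin t = 2 * sin ((real i * t - t) / 2) * cos ((real i * t + t) / 2)"
    by (rule sin_diff_sin)
  moreover have "sin ((real i * t - t) / 2) \<ge> 0"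
  proof (rule sin_ge_zero)
    have "1 * t \<le> real i * t" using assms t by (intro mult_right_mono) auto
    then show "0 \<le> (real i * t - t) / 2" by simp
    show "(real i * t - t) / 2 \<le> pi" using ip t pi_gt_zero by (simp add: algebra_simps del: pi_gt_zero)
  qed
  moreover have "cos ((real i * t + t) / 2) \<ge> 0"
    using ip t by (intro cos_ge_zero) (auto simp: algebra_simps intro: order_trans[of _ 0])
  ultimately have "sin (real i * t) - sin t \<ge> 0"
    by simp
  then have "sin (real i * t) \<ge> sin t" by simp
  then show ?thesis using sin_pos by (simp add: sn_def t_def)
qed

lemma s_pos: "1 \<le> i \<Longrightarrow> i < p \<Longrightarrow> s i > 0"
  using s_ge_1 [of i] by simp

lemma s_p [simp]: "s p = 0"
  using s_reflect [of 0] by simp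

lemma s_nonneg: "i \<le> p \<Longrightarrow> s i \<ge> 0"
  using s_pos [of i] by (metis One_nat_def Suc_leI le_less less_imp_le not_gr_zero s_0 s_p)

lemma s_2: "s (Suc (Suc 0)) = l"
  using s_rec [of 0] by simp

lemma s_p1: "s (p - Suc 0) = 1"
  using s_reflect [of 1] p3 by simp

lemma s_p2: "s (p - 2) = l"
  using s_reflect [of 2] p3 s_2 by (simp add: numeral_2_eq_2)

lemma l_ge_1: "l \<ge> 1"
  using s_ge_1 [of 2] s_2 p3 by (simp add: numeral_2_eq_2)

lemma l_pos: "l > 0"
  using l_ge_1 by simp

lemma s_Suc_Suc_le: "Suc i \<le> p \<Longrightarrow> s (Suc (Suc i)) \<le> l * s (Suc i)"
  using s_rec [of i] s_nonneg [of i] by simp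

text \<open>The left side is the determinant of \<open>U^(i+1)\<close>.\<close>

lemma s_casorati: "s (Suc i) * s (Suc i) - s i * s (Suc (Suc i)) = 1"
proof (induction i)
  case (Suc i)
  have "s (Suc (Suc i)) * s (Suc (Suc i)) - s (Suc i) * s (Suc (Suc (Suc i)))
      = s (Suc i) * s (Suc i) - s i * s (Suc (Suc i))"
    unfolding s_rec [of "Suc i"] by (simp add: s_rec [of i] algebra_simps)
  then show ?case using Suc by simp
qed simp

text \<open>These ratios are successive images of 0 under \<open>U\<close>. By
  \<open>s_casorati\<close>, passing from \<open>j\<close> to \<open>Suc j\<close> subtracts
  \<open>1 / (s j * s (Suc j))\<close>.\<close>

lemma s_ratio_antimono:
  assumes "1 \<le> i" "i \<le> j" "j < p"
  shows "s (Suc j) / s j \<le> s (Suc i) / s i"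
  using assms(2,3)
proof (induction j rule: dec_induct)
  case (step j)
  have pos: "s j > 0" "s (Suc j) > 0" using assms(1) step by (auto intro!: s_pos)
  have "s (Suc (Suc j)) / s (Suc j) \<le> s (Suc j) / s j"
    using pos s_casorati [of j] by (simp add: field_simps)
  then show ?case using step by simp
qed simp

end

section \<open>Tail equivalence along orbits of the group\<close>

text \<open>A frame is a 2 by 2 matrix given by its rows. Its first column is a lift of \<open>\<alpha>\<close> to the
  plane, its second column a lift of the conjugate; digits are read off from the first column.\<close>

type_synonym frame = "(real \<times> real) \<times> (real \<times> real)"

text \<open>The junk value \<open>x / 0 = 0\<close> gives the point at infinity the digit 1; with this choice
  tail equivalence also holds along the orbit of the cusp.\<close>

definition digit :: "real \<Rightarrow> frame \<Rightarrow> int" where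
  "digit l P = \<lfloor>fst (fst P) / fst (snd P) / l\<rfloor> + 1"

text \<open>Nothing is normalised: the quotient of the first column follows the continued fraction,
  while the scale of the columns records multipliers.\<close>

definition cstep :: "real \<Rightarrow> frame \<Rightarrow> frame" where
  "cstep l P = (snd P, (of_int (digit l P) * l) *\<^sub>R snd P - fst P)"

definition act :: "real^2^2 \<Rightarrow> frame \<Rightarrow> frame" where
  "act M P = (M$1$1 *\<^sub>R fst P + M$1$2 *\<^sub>R snd P, M$2$1 *\<^sub>R fst P + M$2$2 *\<^sub>R snd P)"

definition nz :: "frame \<Rightarrow> bool" where
  "nz P \<longleftrightarrow> fst (fst P) \<noteq> 0 \<or> fst (snd P) \<noteq> 0"

text \<open>Signs are ignored because \<open>T\<close> squares to minus the identity.\<close>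

definition teq :: "real \<Rightarrow> frame \<Rightarrow> frame \<Rightarrow> bool" where
  "teq l P Q \<longleftrightarrow> (\<exists>m n. (cstep l ^^ m) P = (cstep l ^^ n) Q \<or> (cstep l ^^ m) P = - (cstep l ^^ n) Q)"

lemma mk2_simps [simp]:
  "mk2 a b c d $ 1 $ 1 = a" "mk2 a b c d $ 1 $ 2 = b"
  "mk2 a b c d $ 2 $ 1 = c" "mk2 a b c d $ 2 $ 2 = d"
  by (simp_all add: mk2_def)

lemma act_mult: "act (A ** B) P = act A (act B P)"
  by (simp add: act_def matrix_matrix_mult_def sum_2 algebra_simps)

lemma act_id: "act (mat 1) P = P"
  by (simp add: act_def mat_def)

lemma digit_minus [simp]: "digit l (- P) = digit l P"
  by (simp add: digit_def)

lemma cstep_minus [simp]: "cstep l (- P) = - cstep l P"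
  by (simp add: cstep_def prod_eq_iff)

lemma cstep_pow_minus [simp]: "(cstep l ^^ n) (- P) = - (cstep l ^^ n) P"
  by (induction n) auto

lemma nz_cstep: "nz P \<Longrightarrow> nz (cstep l P)"
  by (auto simp: nz_def cstep_def)

lemma nz_cstep_pow: "nz P \<Longrightarrow> nz ((cstep l ^^ n) P)"
  by (induction n) (auto intro: nz_cstep)

lemma teq_sym: "teq l P Q \<Longrightarrow> teq l Q P"
  unfolding teq_def by (metis minus_minus)

lemma teq_refl: "teq l P P"
  unfolding teq_def by blast

lemma teq_minus_right [simp]: "teq l P (- Q) \<longleftrightarrow> teq l P Q"
  unfolding teq_def by auto

lemma teq_minus_left [simp]: "teq l (- P) Q \<longleftrightarrow> teq l P Q"
  using teq_minus_right teq_sym by blast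

lemma teq_trans:
  assumes "teq l P Q" "teq l Q R"
  shows "teq l P R"
proof -
  from assms obtain m n i j where
    1: "(cstep l ^^ m) P = (cstep l ^^ n) Q \<or> (cstep l ^^ m) P = - (cstep l ^^ n) Q" and
    2: "(cstep l ^^ i) Q = (cstep l ^^ j) R \<or> (cstep l ^^ i) Q = - (cstep l ^^ j) R"
    unfolding teq_def by blast
  have "(cstep l ^^ (i + m)) P = (cstep l ^^ (n + i)) Q \<or> (cstep l ^^ (i + m)) P = - (cstep l ^^ (n + i)) Q"
    using 1 unfolding add.commute [of n] by (elim disjE) (simp_all add: funpow_add)
  moreover have "(cstep l ^^ (n + i)) Q = (cstep l ^^ (n + j)) R \<or> (cstep l ^^ (n + i)) Q = - (cstep l ^^ (n + j)) R"
    using 2 by (auto simp: funpow_add)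
  ultimately show ?thesis unfolding teq_def by (metis minus_minus)
qed

lemma teq_cstep_pow: "teq l ((cstep l ^^ n) P) P"
  unfolding teq_def by (metis funpow_0)

lemma teq_cstep: "teq l (cstep l P) P"
  using teq_cstep_pow [of l 1] by simp

lemma teq_if_cstep_eq:
  assumes "cstep l P = cstep l Q"
  shows "teq l P Q"
  using teq_trans [OF teq_sym [OF teq_cstep]] teq_cstep [of l Q] unfolding assms [symmetric] by blast

context hecke
begin

section \<open>Runs of digit one and invariance of tails under the generators\<close>

lemma digit_eq_1:
  assumes "fst (snd P) > 0" "fst (fst P) \<ge> 0" "fst (fst P) < l * fst (snd P)"
  shows "digit l P = 1"
proof -
  have "0 \<le> fst (fst P) / fst (snd P) / l" "fst (fst P) / fst (snd P) / l < 1"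
    using assms l_pos by (auto simp: field_simps)
  then have "\<lfloor>fst (fst P) / fst (snd P) / l\<rfloor> = 0" by (simp add: floor_eq_iff)
  then show ?thesis by (simp add: digit_def)
qed

text \<open>The point lies in \<open>[0, 1/l)\<close>, where the first \<open>p - 2\<close> digits
  are all 1, so the steps multiply by powers of the inverse of \<open>U\<close>.\<close>

lemma cstep_pow_ones:
  assumes y: "fst Y > 0" and x: "fst X \<ge> 0" and xy: "l * fst X < fst Y"
  shows "i \<le> p - 3 \<Longrightarrow> (cstep l ^^ Suc i) (X, Y)
    = (s (Suc i) *\<^sub>R Y - s i *\<^sub>R X, s (Suc (Suc i)) *\<^sub>R Y - s (Suc i) *\<^sub>R X)"
proof (induction i)
  \<comment> \<open>All later first coordinates are positive, since
    \<open>s i <= l * s (Suc i)\<close> and \<open>l * fst X < fst Y\<close>. Positivity of the next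
    coordinate is the upper bound that makes the digit 1.\<close>
  have a: "s (Suc i) * fst Y - s i * fst X > 0" if "i < p - 1" for i
  proof -
    have "s i * fst X \<le> l * s (Suc i) * fst X"
      using s_rec [of i] s_nonneg [of "Suc (Suc i)"] that x by (intro mult_right_mono) auto
    also have "\<dots> < s (Suc i) * fst Y"
      using xy s_pos [of "Suc i"] that by (simp add: mult.commute [of l] mult.assoc)
    finally show ?thesis by simp
  qed
  {
    case 0
    have "l * fst Y > fst X"
      using a [of 1] p3 s_2 by simp
    then have "digit l (X, Y) = 1"
      using y x by (intro digit_eq_1) auto
    then show ?case by (simp add: cstep_def s_2)
  next
    case (Suc i)
    let ?Q = "(s (Suc i) *\<^sub>R Y - s i *\<^sub>R X, s (Suc (Suc i)) *\<^sub>R Y - s (Suc i) *\<^sub>R X)"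
    have "digit l ?Q = 1"
    proof (rule digit_eq_1)
      show "fst (snd ?Q) > 0" "fst (fst ?Q) \<ge> 0"
        using a [of i] a [of "Suc i"] Suc.prems by (auto simp: less_imp_le)
      show "fst (fst ?Q) < l * fst (snd ?Q)"
        using a [of "Suc (Suc i)"] Suc.prems by (simp add: s_rec [of "Suc i"] s_rec [of i] algebra_simps)
    qed
    then have "cstep l ?Q = (s (Suc (Suc i)) *\<^sub>R Y - s (Suc i) *\<^sub>R X,
        s (Suc (Suc (Suc i))) *\<^sub>R Y - s (Suc (Suc i)) *\<^sub>R X)"
      unfolding cstep_def s_rec [of "Suc i"] by (simp add: s_rec [of i] algebra_simps)
    then show ?case using Suc by simp
  }
qed

text \<open>Since \<open>U\<close> has order \<open>p\<close> up to sign, \<open>p - 2\<close> inverse steps with digit one amount to \<open>U\<close> squared.\<close>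
lemma cstep_pow_p2:
  assumes "fst Y > 0" "fst X \<ge> 0" "l * fst X < fst Y"
  shows "(cstep l ^^ (p - 2)) (X, Y) = (l *\<^sub>R (Y - l *\<^sub>R X) + X, Y - l *\<^sub>R X)"
proof -
  define i where "i = p - 3"
  have i: "p - 2 = Suc i" "p - Suc 0 = Suc (Suc i)" "i \<le> p - 3" using p3 by (auto simp: i_def)
  have s: "s (Suc (Suc i)) = 1" "s (Suc i) = l" using s_p1 s_p2 by (simp_all only: i)
  then have "s i = l * l - 1" using s_rec [of i] by simp
  then show ?thesis
    unfolding i(1) cstep_pow_ones [OF assms i(3)] s
    by (simp add: scaleR_diff_left scaleR_diff_right)
qed

text \<open>Translation by \<open>l\<close> raises the digit by one, and the step subtracts exactly
  this change.\<close>

lemma cstep_add_l: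
  assumes "fst Y \<noteq> 0"
  shows "cstep l (X + l *\<^sub>R Y, Y) = cstep l (X, Y)"
proof -
  have "digit l (X + l *\<^sub>R Y, Y) = digit l (X, Y) + 1"
  proof -
    have "(fst X + l * fst Y) / fst Y / l = fst X / fst Y / l + 1"
      using assms l_pos by (simp add: field_simps)
    then show ?thesis by (simp add: digit_def)
  qed
  then show ?thesis by (simp add: cstep_def scaleR_left_distrib distrib_right)
qed

text \<open>By \<open>cstep_pow_p2\<close>, after \<open>p - 2\<close> steps the frame is the
  right-hand one translated by \<open>l\<close>, and \<open>cstep_add_l\<close> removes the
  translation.\<close>

lemma teq_sub_l_snd:
  assumes "fst X \<ge> 0" "l * fst X < fst Y"
  shows "teq l (X, Y) (X, Y - l *\<^sub>R X)"
proof -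
  have "0 \<le> l * fst X" using assms l_pos by simp
  then have y: "fst Y > 0" using assms by linarith
  have "teq l (X, Y) (X + l *\<^sub>R (Y - l *\<^sub>R X), Y - l *\<^sub>R X)"
    using teq_sym [OF teq_cstep_pow [of l "p - 2" "(X, Y)"]] cstep_pow_p2 [OF y assms]
    by (simp add: add.commute)
  moreover have "teq l (X + l *\<^sub>R (Y - l *\<^sub>R X), Y - l *\<^sub>R X) (X, Y - l *\<^sub>R X)"
    using assms by (intro teq_if_cstep_eq cstep_add_l) auto
  ultimately show ?thesis by (rule teq_trans)
qed

text \<open>Here \<open>- Y / X\<close> lies in \<open>[-l, 0)\<close>, so the digit is 0 and the
  step just undoes \<open>T\<close>.\<close>

lemma cstep_T_small:
  assumes "fst X > 0" "fst Y > 0" "fst Y \<le> l * fst X"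
  shows "cstep l (- Y, X) = (X, Y)"
proof -
  have "- 1 \<le> - fst Y / fst X / l" "- fst Y / fst X / l < 0"
    using assms l_pos by (auto simp: field_simps)
  then have "\<lfloor>- fst Y / fst X / l\<rfloor> = - 1" by (simp only: floor_eq_iff) simp
  then have "digit l (- Y, X) = 0" by (simp add: digit_def)
  then show ?thesis by (simp add: cstep_def)
qed

text \<open>A Euclidean descent: multiples of \<open>l * X\<close> are taken off \<open>Y\<close>
  until \<open>cstep_T_small\<close> applies. On the side of \<open>(- Y, X)\<close> this is a
  translation, invisible after one step.\<close>

lemma teq_T_pos_bounded:
  "fst X > 0 \<Longrightarrow> fst Y > 0 \<Longrightarrow> fst Y \<le> real (Suc n) * l * fst X \<Longrightarrow> teq l (X, Y) (- Y, X)"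
proof (induction n arbitrary: X Y)
  case base: 0
  then have "cstep l (- Y, X) = (X, Y)" by (intro cstep_T_small) auto
  then show ?case by (metis teq_cstep)
next
  case (Suc n)
  show ?case
  proof (cases "fst Y \<le> l * fst X")
    case True
    then have "cstep l (- Y, X) = (X, Y)" using Suc.prems by (intro cstep_T_small) auto
    then show ?thesis by (metis teq_cstep)
  next
    case False
    have "teq l (X, Y) (X, Y - l *\<^sub>R X)"
      using False Suc.prems by (intro teq_sub_l_snd) auto
    moreover have "teq l (X, Y - l *\<^sub>R X) (- (Y - l *\<^sub>R X), X)"
      using False Suc.prems by (intro Suc.IH) (auto simp: algebra_simps)
    moreover have "teq l (- (Y - l *\<^sub>R X), X) (- Y, X)"
      using cstep_add_l [of X "- Y"] Suc.prems by (intro teq_if_cstep_eq) simp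
    ultimately show ?thesis using teq_trans by blast
  qed
qed

lemma teq_T_pos:
  assumes "fst X > 0" "fst Y > 0"
  shows "teq l (X, Y) (- Y, X)"
proof -
  obtain n where "fst Y / (l * fst X) \<le> real n" using real_arch_simple by blast
  then have "fst Y \<le> real (Suc n) * l * fst X"
    using assms l_pos by (simp add: field_simps) (smt (verit) mult_pos_pos)
  then show ?thesis using teq_T_pos_bounded assms by blast
qed

lemma teq_T_same_sign:
  assumes "fst X * fst Y > 0"
  shows "teq l (X, Y) (- Y, X)"
proof (cases "fst X > 0")
  case True
  then show ?thesis using assms by (intro teq_T_pos) (auto simp: zero_less_mult_iff)
next
  case False
  then have "teq l (- X, - Y) (- (- Y), - X)"
    using assms by (intro teq_T_pos) (auto simp: zero_less_mult_iff)
  moreover have "(- X, - Y) = - (X, Y)" "(- (- Y), - X) = - (- Y, X)" by simp_all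
  ultimately show ?thesis by (metis teq_minus_left teq_minus_right)
qed

text \<open>The first column lifts the point 0 and does not change; only the second column does. So
  \<open>teq_sub_l_snd\<close> can be read backwards, up to sign.\<close>

lemma teq_add_l_snd:
  assumes "fst X = 0" "fst Y \<noteq> 0"
  shows "teq l (X, Y) (X, Y + l *\<^sub>R X)"
proof (cases "fst Y > 0")
  case True
  then have "teq l (X, Y + l *\<^sub>R X) (X, (Y + l *\<^sub>R X) - l *\<^sub>R X)"
    using assms by (intro teq_sub_l_snd) auto
  then show ?thesis using teq_sym [of l "(X, Y + l *\<^sub>R X)" "(X, Y)"] by simp
next
  case False
  then have "teq l (- X, - (Y + l *\<^sub>R X)) (- X, - (Y + l *\<^sub>R X) - l *\<^sub>R (- X))"
    using assms by (intro teq_sub_l_snd) auto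
  moreover have "(- X, - (Y + l *\<^sub>R X)) = - (X, Y + l *\<^sub>R X)"
    "(- X, - (Y + l *\<^sub>R X) - l *\<^sub>R (- X)) = - (X, Y)" by simp_all
  ultimately show ?thesis by (metis teq_minus_left teq_minus_right teq_sym)
qed

lemma teq_T_zero:
  assumes "fst X = 0" "fst Y \<noteq> 0"
  shows "teq l (X, Y) (- Y, X)"
proof -
  \<comment> \<open>The first column of \<open>(- Y, X)\<close> lifts infinity, which has digit 1 by
    the convention on division by zero.\<close>
  have "cstep l (- Y, X) = (X, Y + l *\<^sub>R X)"
    using assms by (simp add: cstep_def digit_def algebra_simps)
  then show ?thesis using teq_add_l_snd [OF assms] by (metis teq_cstep teq_trans)
qed

lemma teq_T:
  assumes "nz (X, Y)"
  shows "teq l (X, Y) (- Y, X)"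
proof -
  \<comment> \<open>Applying \<open>T\<close> twice changes the sign only, so the claim may be
    proved for \<open>(- Y, X)\<close> instead.\<close>
  have *: ?thesis if "teq l (- Y, X) (- X, - Y)"
  proof -
    have "(- X, - Y) = - (X, Y)" by simp
    then show ?thesis using that by (metis teq_minus_right teq_sym)
  qed
  consider "fst X * fst Y > 0" | "fst X * fst Y < 0" | "fst X = 0" "fst Y \<noteq> 0" | "fst X \<noteq> 0" "fst Y = 0"
    using assms unfolding nz_def by (metis fst_conv snd_conv linorder_neqE mult_eq_0_iff)
  then show ?thesis
  proof cases
    case 1 then show ?thesis by (rule teq_T_same_sign)
  next
    case 2
    then show ?thesis using teq_T_same_sign [of "- Y" X] by (intro *) (simp add: mult.commute)
  next
    case 3 then show ?thesis by (rule teq_T_zero)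
  next
    case 4
    then show ?thesis using teq_T_zero [of "- Y" X] by (intro *) simp
  qed
qed

lemma teq_S:
  assumes "nz (X, Y)"
  shows "teq l (X, Y) (X + l *\<^sub>R Y, Y)"
proof (cases "fst Y = 0")
  case True
  \<comment> \<open>At infinity the digit stays 1 under the translation, so the step yields the
    image under \<open>T\<close> up to sign.\<close>
  have "cstep l (X + l *\<^sub>R Y, Y) = (Y, - X)"
    using True by (simp add: cstep_def digit_def)
  also have "\<dots> = - (- Y, X)" by simp
  finally show ?thesis
    using teq_T [OF assms] by (metis teq_cstep teq_minus_right teq_sym teq_trans)
next
  case False
  then show ?thesis by (intro teq_if_cstep_eq cstep_add_l [symmetric])
qed

text \<open>Words grow on the right, so the new letter acts on the frame first and the induction
  hypothesis is needed for the changed frame. Inverse letters reduce to \<open>teq_S\<close> read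
  backwards and to \<open>teq_T\<close> up to sign.\<close>

lemma teq_act:
  assumes "g \<in> Gp l"
  shows "nz P \<Longrightarrow> teq l P (act g P)"
  using assms
proof (induction arbitrary: P rule: Gp.induct)
  case id
  then show ?case by (simp add: act_id teq_refl)
next
  case (mS g)
  have eq: "act (Smat l) P = (fst P + l *\<^sub>R snd P, snd P)" by (simp add: act_def Smat_def)
  have "nz (act (Smat l) P)" using mS.prems unfolding eq by (auto simp: nz_def)
  then have "teq l (act (Smat l) P) (act (g ** Smat l) P)" using mS.IH by (simp add: act_mult)
  moreover have "teq l P (act (Smat l) P)" unfolding eq using teq_S [of "fst P" "snd P"] mS.prems by simp
  ultimately show ?case using teq_trans by blast
next
  case (mSi g)
  have eq: "act (Sinv l) P = (fst P - l *\<^sub>R snd P, snd P)" by (simp add: act_def Sinv_def)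
  have nz: "nz (act (Sinv l) P)" using mSi.prems unfolding eq by (auto simp: nz_def)
  then have "teq l (act (Sinv l) P) (act (g ** Sinv l) P)" using mSi.IH by (simp add: act_mult)
  moreover have "teq l P (act (Sinv l) P)" unfolding eq
    using teq_sym [OF teq_S [of "fst P - l *\<^sub>R snd P" "snd P"]] nz eq by simp
  ultimately show ?case using teq_trans by blast
next
  case (mT g)
  have eq: "act Tmat P = (- snd P, fst P)" by (simp add: act_def Tmat_def)
  have "nz (act Tmat P)" using mT.prems unfolding eq by (auto simp: nz_def)
  then have "teq l (act Tmat P) (act (g ** Tmat) P)" using mT.IH by (simp add: act_mult)
  moreover have "teq l P (act Tmat P)" unfolding eq using teq_T [of "fst P" "snd P"] mT.prems by simp
  ultimately show ?case using teq_trans by blast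
next
  case (mTi g)
  have eq: "act Tinv P = - (- snd P, fst P)" by (simp add: act_def Tinv_def)
  have "nz (act Tinv P)" using mTi.prems unfolding eq by (auto simp: nz_def)
  then have "teq l (act Tinv P) (act (g ** Tinv) P)" using mTi.IH by (simp add: act_mult)
  moreover have "teq l P (act Tinv P)" unfolding eq teq_minus_right
    using teq_T [of "fst P" "snd P"] mTi.prems by simp
  ultimately show ?case using teq_trans by blast
qed

end

section \<open>Hyperbolic elements act by diagonal scaling\<close>

definition scale :: "real \<Rightarrow> real \<Rightarrow> frame \<Rightarrow> frame" where
  "scale \<mu> \<nu> P = ((\<mu> * fst (fst P), \<nu> * snd (fst P)), (\<mu> * fst (snd P), \<nu> * snd (snd P)))"

definition lift_frame :: "real \<Rightarrow> ereal \<Rightarrow> frame" where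
  "lift_frame \<alpha> \<beta> = ((\<alpha>, case \<beta> of ereal b \<Rightarrow> b | _ \<Rightarrow> 1), (1, case \<beta> of ereal b \<Rightarrow> 1 | _ \<Rightarrow> 0))"

text \<open>Scaling columns is right multiplication by a diagonal matrix. It commutes with the left
  multiplication of a step and leaves the quotient defining the digit unchanged.\<close>

lemma cstep_scale: "\<mu> \<noteq> 0 \<Longrightarrow> cstep l (scale \<mu> \<nu> P) = scale \<mu> \<nu> (cstep l P)"
  by (simp add: cstep_def digit_def scale_def algebra_simps)

lemma cstep_pow_scale: "\<mu> \<noteq> 0 \<Longrightarrow> (cstep l ^^ n) (scale \<mu> \<nu> P) = scale \<mu> \<nu> ((cstep l ^^ n) P)"
  by (induction n) (auto simp: cstep_scale)

lemma scale_scale: "scale a b (scale c d P) = scale (a * c) (b * d) P"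
  by (simp add: scale_def)

lemma scale_one [simp]: "scale 1 1 P = P"
  by (simp add: scale_def)

lemma minus_scale: "- scale a b P = scale (- a) (- b) P"
  by (simp add: scale_def)

lemma det_Gp: "g \<in> Gp l \<Longrightarrow> det g = 1"
  by (induction rule: Gp.induct) (simp_all add: det_mul, simp_all add: det_2 Smat_def Sinv_def Tmat_def Tinv_def)

text \<open>Lifts of the two fixed points are eigenvectors, so the eigenvalues have product 1 and
  their sum is the trace. Absolute value 1 would make the trace 2 or -2.\<close>

lemma hyperbolic_scales:
  assumes "det g = 1" "hyperbolic g" "mob g (ereal \<alpha>) = ereal \<alpha>" "mob g \<beta> = \<beta>"
    "is_pt \<beta>" "\<beta> \<noteq> ereal \<alpha>"
  obtains \<mu> \<nu> where "\<mu> * \<nu> = 1" "\<bar>\<mu>\<bar> \<noteq> 1" "act g (lift_frame \<alpha> \<beta>) = scale \<mu> \<nu> (lift_frame \<alpha> \<beta>)"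
proof -
  note obt = that
  define a b c d where abcd: "a = g$1$1" "b = g$1$2" "c = g$2$1" "d = g$2$2"
  have det: "a * d - b * c = 1" using assms(1) by (simp add: det_2 abcd)
  have tr: "\<bar>a + d\<bar> > 2" using assms(2) by (simp add: hyperbolic_def abcd)
  have fp: "c * x + d \<noteq> 0" "a * x + b = (c * x + d) * x" if "mob g (ereal x) = ereal x" for x
  proof -
    show nz: "c * x + d \<noteq> 0" using that by (auto simp: mob_def Let_def abcd)
    then have "(a * x + b) / (c * x + d) = x" using that by (auto simp: mob_def Let_def abcd)
    then show "a * x + b = (c * x + d) * x" using nz by (simp add: field_simps)
  qed
  have *: thesis if "\<mu> * \<nu> = 1" "\<mu> + \<nu> = a + d" "act g (lift_frame \<alpha> \<beta>) = scale \<mu> \<nu> (lift_frame \<alpha> \<beta>)" for \<mu> \<nu>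
  proof (rule obt)
    show "\<mu> * \<nu> = 1" "act g (lift_frame \<alpha> \<beta>) = scale \<mu> \<nu> (lift_frame \<alpha> \<beta>)" by fact+
    show "\<bar>\<mu>\<bar> \<noteq> 1"
    proof
      assume "\<bar>\<mu>\<bar> = 1"
      then have "\<mu> = 1 \<or> \<mu> = - 1" by linarith
      then show False using that tr by auto
    qed
  qed
  show thesis
  proof (cases \<beta>)
    case (real x)
    have x: "x \<noteq> \<alpha>" using assms(6) real by auto
    have f: "a * \<alpha> + b = (c * \<alpha> + d) * \<alpha>" "a * x + b = (c * x + d) * x"
      using fp assms(3,4) real by auto
    \<comment> \<open>Subtracting the fixed point equations leaves the sum of the roots of the fixed
      point quadratic; the product of the roots gives \<open>b\<close> below.\<close>
    have "(x - \<alpha>) * (c * (\<alpha> + x) + d - a) = 0" using f by algebra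
    then have sum: "c * (\<alpha> + x) + d = a" using x by simp
    show thesis
    proof (rule *)
      show "(c * \<alpha> + d) + (c * x + d) = a + d" using sum by (simp add: algebra_simps)
      have b: "b = - (c * \<alpha> * x)" using f(1) unfolding sum [symmetric] by (simp add: algebra_simps)
      show "(c * \<alpha> + d) * (c * x + d) = 1"
        using det unfolding b sum [symmetric] by (simp add: algebra_simps)
      show "act g (lift_frame \<alpha> \<beta>) = scale (c * \<alpha> + d) (c * x + d) (lift_frame \<alpha> \<beta>)"
        using f real by (simp add: act_def lift_frame_def scale_def abcd)
    qed
  next
    case PInf
    have c: "c = 0" using assms(4) PInf by (auto simp: mob_def Let_def abcd split: if_splits)
    show thesis
    proof (rule *)
      show "d + a = a + d" by simp
      show "d * a = 1" using det c by (simp add: mult.commute)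
      show "act g (lift_frame \<alpha> \<beta>) = scale d a (lift_frame \<alpha> \<beta>)"
        using fp(2) [OF assms(3)] c PInf by (simp add: act_def lift_frame_def scale_def abcd)
    qed
  next
    case MInf
    then show thesis using assms(5) by (simp add: is_pt_def)
  qed
qed

text \<open>The orbits of the frame and of its scaled copy meet by \<open>teq_act\<close>. A sign is
  absorbed by negating both multipliers, and interchanging the two times inverts them.\<close>

lemma (in hecke) orbit_eventually_periodic:
  assumes "hecke_pair p \<alpha> \<beta>"
  obtains m n \<mu> \<nu> where "m < n" "\<mu> * \<nu> = 1" "\<bar>\<mu>\<bar> \<noteq> 1"
    "(cstep l ^^ n) (lift_frame \<alpha> \<beta>) = scale \<mu> \<nu> ((cstep l ^^ m) (lift_frame \<alpha> \<beta>))"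
proof -
  let ?P = "lift_frame \<alpha> \<beta>"
  have nz: "nz ?P" by (simp add: nz_def lift_frame_def)
  from assms obtain g where g: "g \<in> Gp l" "hyperbolic g" "mob g (ereal \<alpha>) = ereal \<alpha>" "mob g \<beta> = \<beta>"
    "is_pt \<beta>" "\<beta> \<noteq> ereal \<alpha>" unfolding hecke_pair_def by blast
  obtain \<mu> \<nu> where mu: "\<mu> * \<nu> = 1" "\<bar>\<mu>\<bar> \<noteq> 1" "act g ?P = scale \<mu> \<nu> ?P"
    using hyperbolic_scales [OF det_Gp [OF g(1)] g(2-6)] by blast
  have mu0: "\<mu> \<noteq> 0" using mu(1) by auto
  obtain m n where "(cstep l ^^ m) ?P = (cstep l ^^ n) (act g ?P) \<or>
      (cstep l ^^ m) ?P = - (cstep l ^^ n) (act g ?P)"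
    using teq_act [OF g(1) nz] unfolding teq_def by blast
  then have "(cstep l ^^ m) ?P = scale \<mu> \<nu> ((cstep l ^^ n) ?P) \<or>
      (cstep l ^^ m) ?P = scale (- \<mu>) (- \<nu>) ((cstep l ^^ n) ?P)"
    unfolding mu(3) cstep_pow_scale [OF mu0] minus_scale .
  then obtain \<mu>' \<nu>' where mu': "\<mu>' * \<nu>' = 1" "\<bar>\<mu>'\<bar> \<noteq> 1"
    and eq: "(cstep l ^^ m) ?P = scale \<mu>' \<nu>' ((cstep l ^^ n) ?P)"
    using mu(1,2) by (metis abs_minus_cancel minus_mult_minus)
  consider "n < m" | "m = n" | "m < n" by linarith
  then show thesis
  proof cases
    case 1
    then show thesis using mu' eq by (intro that)
  next
    case 2
    \<comment> \<open>Meeting at equal times would make a nonzero column \<open>\<mu>'\<close> times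
      itself.\<close>
    have "nz ((cstep l ^^ n) ?P)" using nz by (rule nz_cstep_pow)
    moreover have "fst (fst ((cstep l ^^ n) ?P)) = \<mu>' * fst (fst ((cstep l ^^ n) ?P))"
      "fst (snd ((cstep l ^^ n) ?P)) = \<mu>' * fst (snd ((cstep l ^^ n) ?P))"
      using eq unfolding 2 scale_def by (metis fst_conv snd_conv)+
    ultimately have "\<mu>' = 1" by (auto simp: nz_def)
    then show thesis using mu' by simp
  next
    case 3
    have nz': "\<mu>' \<noteq> 0" "\<nu>' \<noteq> 0" using mu'(1) by auto
    have "(cstep l ^^ n) ?P = scale (1 / \<mu>') (1 / \<nu>') ((cstep l ^^ m) ?P)"
      using nz' by (simp add: eq scale_scale)
    moreover have "(1 / \<mu>') * (1 / \<nu>') = 1" using mu'(1) by (simp add: field_simps)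
    moreover have "\<bar>1 / \<mu>'\<bar> \<noteq> 1" using mu'(2) nz' by (simp add: abs_divide)
    ultimately show thesis using 3 by (intro that)
  qed
qed

section \<open>Solutions of the recurrence attached to a digit sequence\<close>

text \<open>The continued fraction steps turn the coordinates of a lift into a solution of the
  recurrence \<open>sol\<close>. Here \<open>\<phi> z n\<close> is the value the solution would take if the block of
  \<open>\<kappa> n\<close> ones starting at \<open>n\<close> were followed by one more digit one, and \<open>\<Phi> z n\<close> is its
  predecessor. For \<open>k = \<kappa> 0\<close>, a projective point lies between 0 and the image of 0 under the
  power \<open>k + 2\<close> of \<open>U\<close> iff \<open>z 0 * \<phi> z 0 > 0\<close>.\<close>

locale hecke_digits = hecke +
  fixes r :: "nat \<Rightarrow> int"
  assumes r_ge_1: "r n \<ge> 1"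
    and r_ne_1: "\<exists>k\<le>p - 3. r (n + k) \<noteq> 1"
begin

definition \<kappa> :: "nat \<Rightarrow> nat" where "\<kappa> n = (LEAST k. r (n + k) \<noteq> 1)"

definition sol :: "(nat \<Rightarrow> real) \<Rightarrow> bool" where
  "sol z \<longleftrightarrow> (\<forall>n. z (Suc (Suc n)) = of_int (r n) * l * z (Suc n) - z n)"

definition \<phi> :: "(nat \<Rightarrow> real) \<Rightarrow> nat \<Rightarrow> real" where
  "\<phi> z n = s (Suc (Suc (\<kappa> n))) * z (Suc n) - s (Suc (\<kappa> n)) * z n"

definition \<Phi> :: "(nat \<Rightarrow> real) \<Rightarrow> nat \<Rightarrow> real" where
  "\<Phi> z n = s (Suc (\<kappa> n)) * z (Suc n) - s (\<kappa> n) * z n"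

lemma r_\<kappa>: "r (n + \<kappa> n) \<noteq> 1"
  unfolding \<kappa>_def using LeastI_ex [of "\<lambda>k. r (n + k) \<noteq> 1"] r_ne_1 by blast

lemma r_less_\<kappa>: "j < \<kappa> n \<Longrightarrow> r (n + j) = 1"
  unfolding \<kappa>_def using not_less_Least by blast

lemma \<kappa>_eqI: "r (n + k) \<noteq> 1 \<Longrightarrow> (\<And>j. j < k \<Longrightarrow> r (n + j) = 1) \<Longrightarrow> \<kappa> n = k"
  by (meson linorder_neqE_nat r_\<kappa> r_less_\<kappa>)

lemma \<kappa>_le: "\<kappa> n \<le> p - 3"
proof -
  obtain k where "k \<le> p - 3" "r (n + k) \<noteq> 1" using r_ne_1 by blast
  then show ?thesis unfolding \<kappa>_def by (meson Least_le le_trans)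
qed

lemma \<kappa>_less: "Suc (Suc (\<kappa> n)) < p"
  using \<kappa>_le [of n] p3 by linarith

lemma \<kappa>_0: "r n \<noteq> 1 \<Longrightarrow> \<kappa> n = 0"
  by (intro \<kappa>_eqI) auto

lemma \<kappa>_Suc: "r n = 1 \<Longrightarrow> \<kappa> n = Suc (\<kappa> (Suc n))"
proof (rule \<kappa>_eqI)
  show "r (n + Suc (\<kappa> (Suc n))) \<noteq> 1" using r_\<kappa> [of "Suc n"] by simp
  show "r (n + j) = 1" if "r n = 1" "j < Suc (\<kappa> (Suc n))" for j
    using that r_less_\<kappa> [of "j - 1" "Suc n"] by (cases j) auto
qed

lemma s_\<kappa>_pos: "s (Suc (\<kappa> n)) > 0" "s (Suc (Suc (\<kappa> n))) \<ge> 1"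
  using \<kappa>_less [of n] by (auto intro!: s_pos s_ge_1)

lemma s_\<kappa>_nonneg: "s (\<kappa> n) \<ge> 0" "s (Suc (Suc (Suc (\<kappa> n)))) \<ge> 0"
  using \<kappa>_less [of n] by (auto intro!: s_nonneg)

lemma solD: "sol z \<Longrightarrow> z (Suc (Suc n)) = of_int (r n) * l * z (Suc n) - z n"
  by (simp add: sol_def)

lemma sol_minus: "sol z \<Longrightarrow> sol (\<lambda>n. - z n)"
  by (simp add: sol_def)

lemma \<phi>_minus: "\<phi> (\<lambda>n. - z n) n = - \<phi> z n"
  by (simp add: \<phi>_def)

lemma \<phi>_0: "r n \<noteq> 1 \<Longrightarrow> \<phi> z n = l * z (Suc n) - z n"
  by (simp add: \<phi>_def \<kappa>_0 s_2)

lemma \<Phi>_0: "r n \<noteq> 1 \<Longrightarrow> \<Phi> z n = z (Suc n)"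
  by (simp add: \<Phi>_def \<kappa>_0)

text \<open>Within a block of ones, \<open>\<phi>\<close> and \<open>\<Phi>\<close> refer to the
  same end of the block and so do not change.\<close>

lemma \<phi>_Suc: "sol z \<Longrightarrow> r n = 1 \<Longrightarrow> \<phi> z (Suc n) = \<phi> z n"
  unfolding \<phi>_def \<kappa>_Suc [of n] solD [of z n] s_rec [of "Suc (\<kappa> (Suc n))"]
  by (simp add: algebra_simps)

lemma \<Phi>_Suc: "sol z \<Longrightarrow> r n = 1 \<Longrightarrow> \<Phi> z (Suc n) = \<Phi> z n"
  unfolding \<Phi>_def \<kappa>_Suc [of n] solD [of z n] s_rec [of "\<kappa> (Suc n)"]
  by (simp add: algebra_simps)

text \<open>For \<open>r n >= 2\<close> both coefficients are nonnegative and the last bracket is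
  \<open>\<phi> z n\<close>; this form makes signs visible.\<close>

lemma \<phi>_Suc_eq:
  assumes "sol z"
  shows "\<phi> z (Suc n) = (s (Suc (Suc (Suc (\<kappa> (Suc n))))) + (of_int (r n) - 2) * l * s (Suc (Suc (\<kappa> (Suc n))))) * z (Suc n)
    + s (Suc (Suc (\<kappa> (Suc n)))) * (l * z (Suc n) - z n)"
  unfolding \<phi>_def solD [OF assms, of n] s_rec [of "Suc (\<kappa> (Suc n))"] by (simp add: algebra_simps)

text \<open>Inverts the linear map from \<open>z n\<close>, \<open>z (Suc n)\<close> to
  \<open>\<Phi> z n\<close>, \<open>\<phi> z n\<close>, whose determinant is given by
  \<open>s_casorati\<close>.\<close>

lemma solution_eq: "z n = s (Suc (Suc (\<kappa> n))) * \<Phi> z n - s (Suc (\<kappa> n)) * \<phi> z n"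
proof -
  have "s (Suc (Suc (\<kappa> n))) * \<Phi> z n - s (Suc (\<kappa> n)) * \<phi> z n
      = (s (Suc (\<kappa> n)) * s (Suc (\<kappa> n)) - s (\<kappa> n) * s (Suc (Suc (\<kappa> n)))) * z n"
    by (simp add: \<phi>_def \<Phi>_def algebra_simps)
  then show ?thesis by (simp add: s_casorati)
qed

lemma pos_step:
  assumes "sol z" "z n > 0" "\<phi> z n > 0"
  shows "z (Suc n) > 0" "\<phi> z (Suc n) > 0"
proof -
  have "0 < s (Suc (\<kappa> n)) * z n" using assms s_\<kappa>_pos by simp
  also have "\<dots> < s (Suc (Suc (\<kappa> n))) * z (Suc n)" using assms by (simp add: \<phi>_def)
  finally show pos: "z (Suc n) > 0" using s_\<kappa>_pos(2) [of n] by (simp add: zero_less_mult_iff)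
  show "\<phi> z (Suc n) > 0"
  proof (cases "r n = 1")
    case True
    then show ?thesis using \<phi>_Suc assms by simp
  next
    case False
    then have "r n \<ge> 2" using r_ge_1 [of n] by linarith
    then have "s (Suc (Suc (Suc (\<kappa> (Suc n))))) + (of_int (r n) - 2) * l * s (Suc (Suc (\<kappa> (Suc n)))) \<ge> 0"
      using s_\<kappa>_pos(2) [of "Suc n"] s_\<kappa>_nonneg(2) [of "Suc n"] l_pos by simp
    moreover have "l * z (Suc n) - z n > 0" using assms(3) False by (simp add: \<phi>_0)
    ultimately show ?thesis
      unfolding \<phi>_Suc_eq [OF assms(1)] using pos s_\<kappa>_pos(2) [of "Suc n"]
      by (intro add_nonneg_pos mult_nonneg_nonneg mult_pos_pos) auto
  qed
qed

text \<open>The product does not see the sign of \<open>z\<close>, so it expresses a condition on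
  the projective point and \<open>pos_step\<close> for \<open>z\<close> or its negative
  suffices.\<close>

lemma R_step:
  assumes "sol z" "z n * \<phi> z n > 0"
  shows "z (Suc n) * \<phi> z (Suc n) > 0"
proof (cases "z n > 0")
  case True
  then show ?thesis using assms pos_step [of z n] by (simp add: zero_less_mult_iff)
next
  case False
  then show ?thesis
    using assms pos_step [OF sol_minus, of z n]
    by (simp add: zero_less_mult_iff \<phi>_minus)
qed

lemma R_mono:
  assumes "sol z" "z m * \<phi> z m > 0" "m \<le> n"
  shows "z n * \<phi> z n > 0"
  using assms(3) by (induction n rule: dec_induct) (use assms(1,2) R_step in auto)

text \<open>In \<open>\<phi>_Suc_eq\<close> the total coefficient of \<open>z (Suc n)\<close> is
  positive and that of \<open>z n\<close> is negative. If \<open>r n = 1\<close>, positivity holds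
  because the block from \<open>n\<close> is one longer and still short enough.\<close>

lemma R_after_sign_change:
  assumes "sol z" "z n \<le> 0" "z (Suc n) > 0"
  shows "z (Suc n) * \<phi> z (Suc n) > 0"
proof -
  let ?k = "\<kappa> (Suc n)"
  have "s (Suc (Suc (Suc ?k))) + (of_int (r n) - 1) * l * s (Suc (Suc ?k)) > 0"
  proof (cases "r n = 1")
    case True
    then have "Suc (Suc (Suc ?k)) < p" using \<kappa>_less [of n] \<kappa>_Suc by simp
    then show ?thesis using True s_pos by simp
  next
    case False
    then have "r n \<ge> 2" using r_ge_1 [of n] by linarith
    then show ?thesis
      using s_\<kappa>_pos(2) [of "Suc n"] s_\<kappa>_nonneg(2) [of "Suc n"] l_pos
      by (intro add_nonneg_pos mult_pos_pos) auto
  qed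
  then have "0 < (s (Suc (Suc (Suc ?k))) + (of_int (r n) - 1) * l * s (Suc (Suc ?k))) * z (Suc n)"
    using assms by simp
  also have "\<dots> \<le> \<phi> z (Suc n)"
    unfolding \<phi>_Suc_eq [OF assms(1)] using s_\<kappa>_pos(2) [of "Suc n"] assms(2)
    by (simp add: algebra_simps mult_nonpos_nonneg)
  finally show ?thesis using assms by simp
qed

lemma sol_nonzero:
  assumes "sol z" "z 0 \<noteq> 0 \<or> z (Suc 0) \<noteq> 0"
  shows "z n \<noteq> 0 \<or> z (Suc n) \<noteq> 0"
  using assms(2) by (induction n) (auto simp: solD [OF assms(1)])

text \<open>A sign change in either direction would produce the condition. A zero would force the
  next value to vanish too, so the solution would be trivial.\<close>

lemma constant_sign:
  assumes z: "sol z" "z 0 \<noteq> 0 \<or> z (Suc 0) \<noteq> 0" and nR: "\<And>n. z n * \<phi> z n \<le> 0"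
  shows "(\<forall>n. z n > 0) \<or> (\<forall>n. z n < 0)"
proof -
  have 1: "z (Suc n) \<le> 0" if "z n \<le> 0" for n
    using R_after_sign_change [OF z(1) that] nR [of "Suc n"] by fastforce
  have 2: "z (Suc n) \<ge> 0" if "z n \<ge> 0" for n
    using R_after_sign_change [OF sol_minus [OF z(1)], of n] nR [of "Suc n"] that
    by (fastforce simp: \<phi>_minus)
  have nz: "z n \<noteq> 0" for n
    using 1 [of n] 2 [of n] sol_nonzero [OF z, of n] by force
  show ?thesis
  proof (cases "z 0 > 0")
    case True
    have "z n > 0" for n
    proof (induction n)
      case (Suc n)
      then show ?case using 2 [of n] nz [of "Suc n"] by linarith
    qed (rule True)
    then show ?thesis by blast
  next
    case False
    have "z n < 0" for n
    proof (induction n)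
      case 0
      then show ?case using False nz [of 0] by linarith
    next
      case (Suc n)
      then show ?case using 1 [of n] nz [of "Suc n"] by linarith
    qed
    then show ?thesis by blast
  qed
qed

section \<open>Multipliers of periodic solutions\<close>

lemma \<Phi>_pos:
  assumes "sol z" "\<And>n. z n > 0"
  shows "\<Phi> z n > 0"
\<comment> \<open>Carried to the end of the block, \<open>\<Phi>\<close> is the value of
  \<open>z\<close> right after it.\<close>
proof (induction "\<kappa> n" arbitrary: n)
  case 0
  then have "r n \<noteq> 1" using \<kappa>_Suc [of n] by auto
  then show ?case using assms by (simp add: \<Phi>_0)
next
  case (Suc k)
  then have "r n = 1" using \<kappa>_0 [of n] by auto
  moreover from this have "k = \<kappa> (Suc n)" using Suc(2) \<kappa>_Suc [of n] by simp
  ultimately show ?case using Suc(1) [of "Suc n"] \<Phi>_Suc [OF assms(1)] by simp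
qed

text \<open>At the end of a block \<open>\<Phi> z n\<close> is \<open>z (Suc n)\<close>; in
  \<open>solution_eq\<close> the term with \<open>\<phi>\<close> only helps and the coefficient of
  \<open>\<Phi>\<close> is at least 1.\<close>

lemma \<Phi>_decreasing:
  assumes "sol z" "\<And>n. z n > 0" "\<And>n. \<phi> z n \<le> 0"
  shows "\<Phi> z (Suc n) \<le> \<Phi> z n"
proof (cases "r n = 1")
  case False
  let ?m = "Suc n"
  have "\<Phi> z ?m \<le> s (Suc (Suc (\<kappa> ?m))) * \<Phi> z ?m"
    using s_\<kappa>_pos(2) [of ?m] \<Phi>_pos [OF assms(1,2), of ?m] by simp
  also have "\<dots> \<le> z ?m"
    using solution_eq [of z ?m] s_\<kappa>_pos(1) [of ?m] assms(3) [of ?m] by (simp add: mult_nonneg_nonpos)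
  finally show ?thesis using False by (simp add: \<Phi>_0)
qed (simp add: \<Phi>_Suc assms)

lemma \<kappa>_periodic: "(\<And>n. r (n + q) = r n) \<Longrightarrow> \<kappa> (n + q) = \<kappa> n"
  unfolding \<kappa>_def by (metis add.assoc add.commute)

lemma multiplier_le_1:
  assumes "sol z" "\<And>n. z n > 0" "\<And>n. \<phi> z n \<le> 0"
    and per: "\<And>n. z (n + q) = \<mu> * z n" "\<And>n. r (n + q) = r n"
  shows "0 < \<mu> \<and> \<mu> \<le> 1"
proof -
  have "\<mu> > 0" using per(1) [of 0] assms(2) [of 0] assms(2) [of q] by (simp add: zero_less_mult_iff)
  have "\<Phi> z (0 + q) = \<mu> * \<Phi> z 0"
    unfolding \<Phi>_def \<kappa>_periodic [OF per(2)] using per(1) [of 0] per(1) [of 1] by (simp add: algebra_simps)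
  moreover have "\<Phi> z n \<le> \<Phi> z 0" for n
    by (induction n) (use \<Phi>_decreasing [OF assms(1-3)] order_trans in auto)
  ultimately have "\<mu> * \<Phi> z 0 \<le> 1 * \<Phi> z 0" by (metis mult_1)
  then show ?thesis using \<Phi>_pos [OF assms(1,2), of 0] \<open>\<mu> > 0\<close> by simp
qed

lemma R_or_multiplier_le_1:
  assumes z: "sol z" "z 0 \<noteq> 0 \<or> z (Suc 0) \<noteq> 0"
    and per: "\<And>n. z (n + q) = \<mu> * z n" "\<And>n. r (n + q) = r n" "\<mu> \<noteq> 0" "q \<ge> 1"
  shows "z 0 * \<phi> z 0 > 0 \<or> 0 < \<mu> \<and> \<mu> \<le> 1"
proof (cases "\<exists>n. z n * \<phi> z n > 0")
  case True
  then obtain n where n: "z n * \<phi> z n > 0" by blast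
  \<comment> \<open>Over a period the product is multiplied by the square of \<open>\<mu>\<close>,
    so the condition also passes back by whole periods. It is first carried forward to a multiple of
    \<open>q\<close>.\<close>
  have desc: "z m * \<phi> z m > 0" if "z (m + q) * \<phi> z (m + q) > 0" for m
  proof -
    have "\<phi> z (m + q) = \<mu> * \<phi> z m"
      unfolding \<phi>_def \<kappa>_periodic [OF per(2)] using per(1) [of m] per(1) [of "Suc m"] by (simp add: algebra_simps)
    then have "\<mu>\<^sup>2 * (z m * \<phi> z m) > 0" using that per(1) [of m] by (simp add: power2_eq_square mult_ac)
    then show ?thesis by (simp add: zero_less_mult_iff not_less)
  qed
  have "z 0 * \<phi> z 0 > 0" if "z (t * q) * \<phi> z (t * q) > 0" for t
    using that
  proof (induction t)
    case (Suc t)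
    then show ?case using desc [of "t * q"] by (simp add: add.commute)
  qed simp
  moreover have "n \<le> n * q" using per(4) by simp
  ultimately show ?thesis using R_mono [OF z(1) n] by blast
next
  case False
  then have nR: "z n * \<phi> z n \<le> 0" for n by (simp add: not_less)
  consider "\<forall>n. z n > 0" | "\<forall>n. z n < 0" using constant_sign [OF z nR] by blast
  then have "0 < \<mu> \<and> \<mu> \<le> 1"
  proof cases
    case 1
    then have "\<phi> z n \<le> 0" for n using nR [of n] by (simp add: mult_le_0_iff) (smt (verit))
    then show ?thesis using multiplier_le_1 [OF z(1)] 1 per by blast
  next
    case 2
    then have "\<phi> (\<lambda>n. - z n) n \<le> 0" for n using nR [of n] by (simp add: mult_le_0_iff \<phi>_minus) (smt (verit))
    moreover have "- z (n + q) = \<mu> * - z n" for n using per(1) by simp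
    ultimately show ?thesis using multiplier_le_1 [OF sol_minus [OF z(1)]] 2 per by (metis neg_0_less_iff_less)
  qed
  then show ?thesis by blast
qed

text \<open>A solution with \<open>\<phi> z 0 = 0\<close> belongs to a parabolic point, whose multiplier is 1.\<close>
lemma \<phi>_nonzero:
  assumes "sol z" "\<And>n. z n > 0" "\<And>n. \<phi> z n \<le> 0"
    and per: "\<And>n. z (n + q) = \<mu> * z n" "\<And>n. r (n + q) = r n" and "\<mu> \<noteq> 1"
  shows "\<phi> z 0 \<noteq> 0"
proof
  assume 0: "\<phi> z 0 = 0"
  have step: "\<phi> z (Suc n) = 0 \<and> \<Phi> z (Suc n) = \<Phi> z n" if n: "\<phi> z n = 0" for n
  proof (cases "r n = 1")
    case True
    then show ?thesis using n \<phi>_Suc \<Phi>_Suc assms(1) by simp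
  next
    case False
    let ?k = "\<kappa> (Suc n)"
    have r: "r n \<ge> 2" using False r_ge_1 [of n] by linarith
    have eq: "\<phi> z (Suc n) = (s (Suc (Suc (Suc ?k))) + (of_int (r n) - 2) * l * s (Suc (Suc ?k))) * z (Suc n)"
      unfolding \<phi>_Suc_eq [OF assms(1)] using n False by (simp add: \<phi>_0)
    have nonneg: "(of_int (r n) - 2) * l * s (Suc (Suc ?k)) \<ge> 0"
      using r l_pos s_\<kappa>_pos(2) [of "Suc n"] by simp
    \<comment> \<open>Two nonnegative terms with sum at most 0 vanish. Then
      \<open>?k + 3 = p\<close>, so the coefficient of \<open>\<Phi>\<close> in
      \<open>solution_eq\<close> is \<open>s (p - 1) = 1\<close> and \<open>\<Phi>\<close> stays
      constant.\<close>
    have "s (Suc (Suc (Suc ?k))) + (of_int (r n) - 2) * l * s (Suc (Suc ?k)) \<le> 0"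
      using assms(3) [of "Suc n"] assms(2) [of "Suc n"] unfolding eq by (simp add: mult_le_0_iff)
    then have s0: "s (Suc (Suc (Suc ?k))) = 0" "(of_int (r n) - 2) * l * s (Suc (Suc ?k)) = 0"
      using nonneg s_\<kappa>_nonneg(2) [of "Suc n"] by linarith+
    then have zero: "\<phi> z (Suc n) = 0" using eq by simp
    have "Suc (Suc (Suc ?k)) = p"
      using s0(1) s_pos [of "Suc (Suc (Suc ?k))"] \<kappa>_less [of "Suc n"] by force
    then have "p - Suc 0 = Suc (Suc ?k)" by simp
    then have "s (Suc (Suc ?k)) = 1" using s_p1 by simp
    then show ?thesis using zero solution_eq [of z "Suc n"] False by (simp add: \<Phi>_0)
  qed
  have "\<phi> z n = 0 \<and> \<Phi> z n = \<Phi> z 0" for n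
    by (induction n) (use 0 step in auto)
  then have "\<Phi> z (0 + q) = \<Phi> z 0" by blast
  moreover have "\<Phi> z (0 + q) = \<mu> * \<Phi> z 0"
    unfolding \<Phi>_def \<kappa>_periodic [OF per(2)] using per(1) [of 0] per(1) [of 1] by (simp add: algebra_simps)
  ultimately show False using \<Phi>_pos [OF assms(1,2), of 0] \<open>\<mu> \<noteq> 1\<close> by simp
qed

lemma R_ratio:
  assumes "z n * \<phi> z n > 0"
  shows "0 < z n / z (Suc n)" "z n / z (Suc n) < l"
proof -
  have *: "z n / z (Suc n) > 0 \<and> z n / z (Suc n) < l" if "z n > 0" "\<phi> z n > 0" for z :: "nat \<Rightarrow> real"
  proof -
    have "0 < s (Suc (\<kappa> n)) * z n" using that s_\<kappa>_pos by simp
    also have lt: "\<dots> < s (Suc (Suc (\<kappa> n))) * z (Suc n)" using that by (simp add: \<phi>_def)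
    finally have pos: "z (Suc n) > 0" using s_\<kappa>_pos(2) [of n] by (simp add: zero_less_mult_iff)
    have "s (Suc (Suc (\<kappa> n))) * z (Suc n) \<le> l * s (Suc (\<kappa> n)) * z (Suc n)"
      using s_Suc_Suc_le [of "\<kappa> n"] \<kappa>_less [of n] pos by (intro mult_right_mono) auto
    then have "s (Suc (\<kappa> n)) * z n < s (Suc (\<kappa> n)) * (l * z (Suc n))" using lt by (simp add: mult_ac)
    then have "z n < l * z (Suc n)" using s_\<kappa>_pos(1) [of n] by simp
    then show ?thesis using pos that by (simp add: field_simps)
  qed
  have "0 < z n / z (Suc n) \<and> z n / z (Suc n) < l"
  proof (cases "z n > 0")
    case True
    then show ?thesis using assms * [of z] by (simp add: zero_less_mult_iff)
  next
    case False
    then show ?thesis using assms * [of "\<lambda>n. - z n"] by (simp add: zero_less_mult_iff \<phi>_minus)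
  qed
  then show "0 < z n / z (Suc n)" "z n / z (Suc n) < l" by auto
qed

text \<open>The reciprocal of the image point is \<open>r * l\<close> minus a number in
  \<open>(0, l)\<close>, by \<open>R_ratio\<close>. Equal images thus give integers differing by
  less than 1.\<close>

lemma digit_determined_backwards:
  assumes "sol z" "z m * \<phi> z m > 0" "z n * \<phi> z n > 0"
    and "z (Suc (Suc m)) / z (Suc m) = z (Suc (Suc n)) / z (Suc n)"
  shows "r m = r n"
proof -
  have eq: "z (Suc (Suc i)) / z (Suc i) = of_int (r i) * l - z i / z (Suc i)" if "z i * \<phi> z i > 0" for i
    using R_ratio(1) [OF that] by (cases "z (Suc i) = 0") (auto simp: solD [OF assms(1)] diff_divide_distrib)
  define a b where "a = z m / z (Suc m)" "b = z n / z (Suc n)"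
  have ab: "0 < a" "a < l" "0 < b" "b < l" unfolding a_b_def using R_ratio assms(2,3) by auto
  have "of_int (r m) * l - a = of_int (r n) * l - b"
    using assms(4) eq assms(2,3) by (simp add: a_b_def)
  then have "(of_int (r m) - of_int (r n)) * l = a - b" by (simp add: algebra_simps)
  then have "\<bar>(of_int (r m) - of_int (r n)) * l\<bar> < 1 * l" using ab by simp
  then have "\<bar>of_int (r m) - of_int (r n) :: real\<bar> < 1" using l_pos by (simp add: abs_mult)
  then show ?thesis by linarith
qed

text \<open>Across a digit 2 the next block has \<open>p - 3\<close> ones, so \<open>\<phi>\<close>
  becomes \<open>z (n+2) - l * z (n+1)\<close>, which equals \<open>l * z (n+1) - z n\<close> by the
  recurrence.\<close>

lemma \<phi>_const_if_parabolic_digits: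
  assumes "sol z" "\<And>j. r j = (if j mod (p - 2) = 0 then 2 else 1)"
  shows "\<phi> z n = \<phi> z 0"
proof (induction n)
  case (Suc n)
  have "\<phi> z (Suc n) = \<phi> z n"
  proof (cases "n mod (p - 2) = 0")
    case True
    then have r: "r n = 2" using assms by simp
    have "\<kappa> (Suc n) = p - 3"
    proof (rule \<kappa>_eqI)
      have "(Suc n + (p - 3)) mod (p - 2) = 0" using True p3
        by (metis Suc_diff_Suc add_Suc_shift less_eq_Suc_le mod_add_self2 numeral_2_eq_2 numeral_3_eq_3)
      then show "r (Suc n + (p - 3)) \<noteq> 1" using assms(2) by simp
      show "r (Suc n + j) = 1" if "j < p - 3" for j
      proof -
        have "(n + Suc j) mod (p - 2) = Suc j mod (p - 2)"
          using True by (metis add_0 mod_add_left_eq)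
        also have "\<dots> = Suc j" using that by simp
        finally show ?thesis using assms(2) by simp
      qed
    qed
    moreover have "Suc (Suc (p - 3)) = p - Suc 0" "Suc (p - 3) = p - 2" using p3 by auto
    ultimately have "\<phi> z (Suc n) = z (Suc (Suc n)) - l * z (Suc n)"
      unfolding \<phi>_def by (simp only: s_p1 s_p2)
    then show ?thesis using r by (simp add: solD [OF assms(1)] \<phi>_0)
  next
    case False
    then show ?thesis using assms by (intro \<phi>_Suc) auto
  qed
  then show ?case using Suc by simp
qed simp

end

section \<open>The orbit of 0 under U\<close>

context hecke
begin

lemma mob_U:
  "mob (Umat l) (ereal x) = (if x = 0 then \<infinity> else ereal (l - 1 / x))"
  "mob (Umat l) \<infinity> = ereal l"
  by (auto simp: mob_def Umat_def Smat_def Tmat_def matrix_matrix_mult_def sum_2 Let_def diff_divide_distrib)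

lemma U_iterate:
  "i < p \<Longrightarrow> (mob (Umat l) ^^ Suc i) 0 = (if i = 0 then \<infinity> else ereal (s (Suc i) / s i))"
proof (induction i)
  case 0
  then show ?case using mob_U(1) [of 0] by (simp add: zero_ereal_def)
next
  case (Suc i)
  show ?case
  proof (cases "i = 0")
    case True
    then show ?thesis using mob_U Suc by (simp add: s_2)
  next
    case False
    have pos: "s i > 0" "s (Suc i) > 0" using Suc.prems False by (auto intro!: s_pos)
    have "(mob (Umat l) ^^ Suc (Suc i)) 0 = mob (Umat l) (ereal (s (Suc i) / s i))"
      using Suc False by simp
    also have "\<dots> = ereal (s (Suc (Suc i)) / s (Suc i))"
      using pos by (simp add: mob_U s_rec [of i] diff_divide_distrib)
    finally show ?thesis by simp
  qed
qed

lemma U_order_p: "(mob (Umat l) ^^ p) 0 = 0"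
  using U_iterate [of "p - 1"] p3 by (simp add: zero_ereal_def)

text \<open>Multiplying out the denominators covers \<open>k = 0\<close> as well, where
  \<open>U\<close> sends 0 to infinity and \<open>s 0 = 0\<close>.\<close>

lemma Ucond_iff:
  assumes "k \<le> p - 3"
  shows "Ucond p \<alpha> \<beta> k \<longleftrightarrow>
    (\<exists>b. \<beta> = ereal b \<and> 0 < b \<and> s (Suc k) * b < s (Suc (Suc k))) \<and>
    s (Suc (Suc k)) < s (Suc k) * \<alpha> \<and> s k * \<alpha> < s (Suc k)"
proof -
  have pos: "s (Suc k) > 0" using assms p3 by (intro s_pos) auto
  have 2: "(mob (Umat l) ^^ (k + 2)) 0 = ereal (s (Suc (Suc k)) / s (Suc k))"
    using U_iterate [of "Suc k"] assms p3 by simp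
  have 1: "(mob (Umat l) ^^ (k + 1)) 0 = (if k = 0 then \<infinity> else ereal (s (Suc k) / s k))"
    using U_iterate [of k] assms p3 by simp
  have 3: "ereal \<alpha> < (mob (Umat l) ^^ (k + 1)) 0 \<longleftrightarrow> s k * \<alpha> < s (Suc k)"
    using s_pos [of k] assms p3 unfolding 1 by (cases "k = 0") (auto simp: field_simps)
  have 4: "0 < \<beta> \<and> \<beta> < ereal c \<longleftrightarrow> (\<exists>b. \<beta> = ereal b \<and> 0 < b \<and> b < c)" for c
    by (cases \<beta>) auto
  let ?c = "s (Suc (Suc k)) / s (Suc k)"
  have "Ucond p \<alpha> \<beta> k \<longleftrightarrow> (0 < \<beta> \<and> \<beta> < ereal ?c) \<and> ereal ?c < ereal \<alpha> \<and> s k * \<alpha> < s (Suc k)"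
    unfolding Ucond_def 2 3 by blast
  then show ?thesis
    unfolding 4 using pos by (simp add: pos_less_divide_eq pos_divide_less_eq mult.commute)
qed

text \<open>For \<open>k = p - 2\<close> the upper bound on \<beta> is 0, for
  \<open>k = p - 1\<close> the lower bound on \<alpha> is infinity, and larger \<open>k\<close> can
  be lowered by the period \<open>p\<close>.\<close>

lemma Ucond_le:
  assumes "Ucond p \<alpha> \<beta> k" "\<And>j. j < k \<Longrightarrow> \<not> Ucond p \<alpha> \<beta> j"
  shows "k \<le> p - 3"
proof (rule ccontr)
  assume "\<not> k \<le> p - 3"
  then consider "k + 2 = p" | "k + 1 = p" | "k \<ge> p" using p3 by linarith
  then show False
  proof cases
    case 1
    then show False using assms(1) U_order_p by (simp only: Ucond_def) auto
  next
    case 2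
    then have "(mob (Umat l) ^^ (k + 2)) 0 = mob (Umat l) 0" using U_order_p by auto
    then show False using assms(1) mob_U(1) [of 0] by (simp add: Ucond_def zero_ereal_def)
  next
    case 3
    have "(mob (Umat l) ^^ (j + p)) 0 = (mob (Umat l) ^^ j) 0" for j
      by (simp add: funpow_add U_order_p)
    from this [of "k - p + 2"] this [of "k - p + 1"] have "Ucond p \<alpha> \<beta> (k - p)"
      using assms(1) 3 by (simp add: Ucond_def)
    then show False using assms(2) [of "k - p"] 3 p3 by auto
  qed
qed

lemma blocks_disjoint:
  assumes "s (Suc (Suc i)) \<le> s (Suc i) * a" "s j * a < s (Suc j)" "j \<le> p - 3"
  shows "j \<le> i"
proof (rule ccontr)
  assume "\<not> j \<le> i"
  then have ij: "i < j" "j < p" using assms(3) p3 by linarith+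
  have "s (Suc i) > 0" "s j > 0" using ij assms(3) p3 by (auto intro!: s_pos)
  then have "s (Suc (Suc i)) / s (Suc i) \<le> a" "a < s (Suc j) / s j"
    using assms by (auto simp: field_simps)
  then show False
    using s_ratio_antimono [of "Suc i" j] ij by simp
qed

text \<open>For indices up to \<open>p - 3\<close> the intervals for \<alpha> are disjoint, so at
  most one such index can satisfy the condition.\<close>

lemma Ucond_least_iff:
  "Ucond p \<alpha> \<beta> k \<and> (\<forall>j<k. \<not> Ucond p \<alpha> \<beta> j) \<longleftrightarrow> k \<le> p - 3 \<and> Ucond p \<alpha> \<beta> k"
proof -
  have "\<not> Ucond p \<alpha> \<beta> j" if k: "k \<le> p - 3" "Ucond p \<alpha> \<beta> k" and j: "j < k" for j
  proof
    assume "Ucond p \<alpha> \<beta> j"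
    then have "s (Suc (Suc j)) \<le> s (Suc j) * \<alpha>" "s k * \<alpha> < s (Suc k)"
      using k j by (auto simp: Ucond_iff)
    then show False using blocks_disjoint k j by (meson not_le)
  qed
  then show ?thesis using Ucond_le by blast
qed

end

section \<open>The continued fraction of a hyperbolic fixed point\<close>

locale hecke_point = hecke +
  fixes \<alpha> :: real and \<beta> :: ereal
  assumes pair: "hecke_pair p \<alpha> \<beta>"
begin

text \<open>A step moves the second row up, so consecutive frames overlap and the orbit is a single
  sequence of rows.\<close>

definition row :: "nat \<Rightarrow> real \<times> real" where "row n = fst ((cstep l ^^ n) (lift_frame \<alpha> \<beta>))"

abbreviation x :: "nat \<Rightarrow> real" where "x n \<equiv> fst (row n)"
abbreviation w :: "nat \<Rightarrow> real" where "w n \<equiv> snd (row n)"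

abbreviation r :: "nat \<Rightarrow> int" where "r n \<equiv> cf_digit l \<alpha> n"

lemma cstep_pow_rows: "(cstep l ^^ n) (lift_frame \<alpha> \<beta>) = (row n, row (Suc n))"
  by (simp add: row_def cstep_def)

lemma x_0: "x 0 = \<alpha>" and x_1: "x (Suc 0) = 1"
  by (simp_all add: row_def cstep_def lift_frame_def)

lemma w_0: "w 0 = (case \<beta> of ereal b \<Rightarrow> b | _ \<Rightarrow> 1)" and w_1: "w (Suc 0) = (case \<beta> of ereal b \<Rightarrow> 1 | _ \<Rightarrow> 0)"
  by (simp_all add: row_def cstep_def lift_frame_def)

lemma row_rec: "row (Suc (Suc n)) = (of_int (\<lfloor>x n / x (Suc n) / l\<rfloor> + 1) * l) *\<^sub>R row (Suc n) - row n"
proof -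
  have "(row (Suc n), row (Suc (Suc n))) = cstep l (row n, row (Suc n))"
    using cstep_pow_rows [of n] cstep_pow_rows [of "Suc n"] by simp
  then show ?thesis by (simp add: cstep_def digit_def)
qed

lemma x_pos_cf_alpha: "x (Suc n) > 0 \<and> cf_alpha l \<alpha> n = x n / x (Suc n)"
proof (induction n)
  case (Suc n)
  let ?d = "of_int (\<lfloor>x n / x (Suc n) / l\<rfloor> + 1) * l - x n / x (Suc n)"
  have eq: "x (Suc (Suc n)) = x (Suc n) * ?d"
    unfolding row_rec right_diff_distrib using Suc by simp
  have "x n / x (Suc n) / l < of_int (\<lfloor>x n / x (Suc n) / l\<rfloor> + 1)" by linarith
  then have "?d > 0" using l_pos by (simp only: pos_divide_less_eq)
  then have "x (Suc (Suc n)) > 0" unfolding eq using Suc by simp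
  moreover have "cf_alpha l \<alpha> (Suc n) = 1 / ?d" using Suc by (simp only: cf_alpha.simps)
  moreover have "1 / ?d = x (Suc n) / x (Suc (Suc n))" unfolding eq using Suc by simp
  ultimately show ?case by simp
qed (simp_all add: x_0 x_1)

lemma x_pos: "x (Suc n) > 0"
  using x_pos_cf_alpha by blast

lemma r_eq: "r n = \<lfloor>x n / x (Suc n) / l\<rfloor> + 1"
  using x_pos_cf_alpha [of n] by (simp add: cf_digit_def)

lemma rec:
  "x (Suc (Suc n)) = of_int (r n) * l * x (Suc n) - x n"
  "w (Suc (Suc n)) = of_int (r n) * l * w (Suc n) - w n"
  by (simp_all only: row_rec r_eq) simp_all

lemma r_bounds: "of_int (r n - 1) * (l * x (Suc n)) \<le> x n" "x n < of_int (r n) * (l * x (Suc n))"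
proof -
  have "of_int (r n - 1) \<le> x n / (l * x (Suc n))" "x n / (l * x (Suc n)) < of_int (r n)"
    unfolding r_eq by (simp_all add: mult.commute)
  moreover have "l * x (Suc n) > 0" using l_pos x_pos by simp
  ultimately show "of_int (r n - 1) * (l * x (Suc n)) \<le> x n" "x n < of_int (r n) * (l * x (Suc n))"
    by (simp_all only: pos_le_divide_eq pos_divide_less_eq)
qed

text \<open>Every complete quotient after the first is at least \<open>1 / l\<close>.\<close>

lemma x_Suc_Suc_le: "x (Suc (Suc n)) \<le> l * x (Suc n)"
  using r_bounds(1) [of n] by (simp add: rec algebra_simps)

text \<open>From \<open>\<alpha> >= 1 / l\<close> on, all points are positive, so digits are at
  least 1. A run of \<open>p - 2\<close> ones would lead to the coordinate
  \<open>x (Suc n) - l * x n\<close>, which is not positive.\<close>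

lemma digits:
  assumes "\<alpha> > 0" "1 \<le> l * \<alpha>"
  shows "hecke_digits p r"
proof
  have pos: "x n > 0" for n using x_pos [of "n - 1"] assms x_0 by (cases n) auto
  show "r n \<ge> 1" for n
  proof -
    have "0 < of_int (r n) * (l * x (Suc n))" using r_bounds(2) [of n] pos [of n] by linarith
    moreover have "l * x (Suc n) > 0" using l_pos pos by simp
    ultimately show ?thesis by (simp add: zero_less_mult_iff)
  qed
  show "\<exists>k\<le>p - 3. r (n + k) \<noteq> 1" for n
  proof (rule ccontr)
    assume "\<not> ?thesis"
    then have one: "r (n + k) = 1" if "k \<le> p - 3" for k using that by blast
    \<comment> \<open>\<open>s (Suc i) - l * s i\<close> is minus the value of \<open>s\<close> at \<open>i - 1\<close>, also for \<open>i = 0\<close>.\<close>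
    have run: "x (n + i) = s i * x (Suc n) + (s (Suc i) - l * s i) * x n
        \<and> x (Suc (n + i)) = s (Suc i) * x (Suc n) - s i * x n" if "i \<le> p - 2" for i
      using that
    proof (induction i)
      case (Suc i)
      then have "r (n + i) = 1" by (intro one) simp
      then have rec': "x (Suc (Suc (n + i))) = l * x (Suc (n + i)) - x (n + i)"
        by (simp add: rec)
      have a: "x (n + i) = s i * x (Suc n) + (s (Suc i) - l * s i) * x n"
        and b: "x (Suc (n + i)) = s (Suc i) * x (Suc n) - s i * x n" using Suc by auto
      have "x (Suc (Suc (n + i))) = s (Suc (Suc i)) * x (Suc n) - s (Suc i) * x n"
        unfolding rec' a b s_rec [of i] by (simp add: algebra_simps)
      then show ?case using b by (simp add: s_rec [of i])
    qed simp
    have "Suc (p - 2) = p - Suc 0" using p3 by simp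
    then have "x (Suc (n + (p - 2))) = x (Suc n) - l * x n"
      using run [of "p - 2"] s_p1 s_p2 by simp
    then have "l * x n < x (Suc n)" using pos [of "Suc (n + (p - 2))"] by simp
    then show False using x_Suc_Suc_le [of "n - 1"] assms x_0 x_1 by (cases n) auto
  qed
qed

text \<open>The recurrence can be run backwards once the digit is known. The second premise supplies
  it, from reducedness in one direction and from the conjugate in the other.\<close>

lemma periodic_all:
  assumes "\<And>j. m \<le> j \<Longrightarrow> x (j + q) = \<mu> * x j \<and> w (j + q) = \<nu> * w j"
    and "\<And>j. (\<And>i. j < i \<Longrightarrow> x (i + q) = \<mu> * x i \<and> w (i + q) = \<nu> * w i) \<Longrightarrow> r (j + q) = r j"
  shows "x (j + q) = \<mu> * x j \<and> w (j + q) = \<nu> * w j"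
proof -
  have "\<forall>j\<ge>m - i. x (j + q) = \<mu> * x j \<and> w (j + q) = \<nu> * w j" for i
  proof (induction i)
    case 0
    then show ?case using assms(1) by simp
  next
    case (Suc i)
    show ?case
    proof (intro allI impI)
      fix j assume j: "m - Suc i \<le> j"
      show "x (j + q) = \<mu> * x j \<and> w (j + q) = \<nu> * w j"
      proof (cases "m - i \<le> j")
        case True
        then show ?thesis using Suc by blast
      next
        case False
        then have later: "x (i + q) = \<mu> * x i \<and> w (i + q) = \<nu> * w i" if "j < i" for i
          using that j Suc by auto
        have "r (j + q) = r j" using later by (rule assms(2))
        then show ?thesis
          using later [of "Suc j"] later [of "Suc (Suc j)"] rec [of j] rec [of "j + q"]
          by (simp add: algebra_simps)
      qed
    qed
  qed
  from this [of m] show ?thesis by simp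
qed

lemma eventually_periodic:
  obtains m q \<mu> \<nu> where "q \<ge> 1" "\<mu> * \<nu> = 1" "\<bar>\<mu>\<bar> \<noteq> 1"
    "\<And>j. m \<le> j \<Longrightarrow> x (j + q) = \<mu> * x j \<and> w (j + q) = \<nu> * w j"
proof -
  let ?P = "lift_frame \<alpha> \<beta>"
  obtain m n \<mu> \<nu> where mn: "m < n" "\<mu> * \<nu> = 1" "\<bar>\<mu>\<bar> \<noteq> 1"
    and eq: "(cstep l ^^ n) ?P = scale \<mu> \<nu> ((cstep l ^^ m) ?P)"
    using orbit_eventually_periodic [OF pair] by blast
  have mu0: "\<mu> \<noteq> 0" using mn by auto
  have *: "(cstep l ^^ (i + n)) ?P = scale \<mu> \<nu> ((cstep l ^^ (i + m)) ?P)" for i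
    by (simp add: funpow_add eq cstep_pow_scale [OF mu0])
  have "x (j + (n - m)) = \<mu> * x j \<and> w (j + (n - m)) = \<nu> * w j" if "m \<le> j" for j
    using * [of "j - m"] that mn(1) by (simp add: row_def scale_def)
  then show thesis using mn by (intro that [of "n - m" \<mu> \<nu> m]) auto
qed

lemma reduced_imp_periodic:
  assumes "Gp_reduced p \<alpha>"
  obtains q \<mu> \<nu> where "q \<ge> 1" "\<mu> * \<nu> = 1" "\<bar>\<mu>\<bar> \<noteq> 1"
    "\<And>j. x (j + q) = \<mu> * x j" "\<And>j. w (j + q) = \<nu> * w j" "\<And>j. r (j + q) = r j"
proof -
  obtain m0 where m0: "m0 \<ge> 1" "\<And>j. r (j + m0) = r j"
    using assms unfolding Gp_reduced_def by blast
  obtain m q \<mu> \<nu> where q: "q \<ge> 1" "\<mu> * \<nu> = 1" "\<bar>\<mu>\<bar> \<noteq> 1"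
    "\<And>j. m \<le> j \<Longrightarrow> x (j + q) = \<mu> * x j \<and> w (j + q) = \<nu> * w j"
    by (rule eventually_periodic) blast
  have r: "r (j + t * m0) = r j" for j t
  proof (induction t)
    case (Suc t)
    then show ?case using m0(2) [of "j + t * m0"] by (simp add: add.assoc add.commute [of m0])
  qed simp
  have "x (j + t * q) = \<mu> ^ t * x j \<and> w (j + t * q) = \<nu> ^ t * w j" if "m \<le> j" for j t
  proof (induction t)
    case (Suc t)
    have eq: "j + Suc t * q = j + t * q + q" and "m \<le> j + t * q" using that by simp_all
    then show ?case unfolding eq using q(4) [of "j + t * q"] Suc by simp
  qed simp
  \<comment> \<open>The common period \<open>m0 * q\<close> serves both the digits and the rows; the
    multipliers become powers.\<close>
  note ev = this [of _ m0]
  have rq: "r (j + m0 * q) = r j" for j using r [of j q] by (simp add: mult.commute)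
  have all: "x (j + m0 * q) = \<mu> ^ m0 * x j \<and> w (j + m0 * q) = \<nu> ^ m0 * w j" for j
    by (rule periodic_all [of m "m0 * q" "\<mu> ^ m0" "\<nu> ^ m0" j]) (rule ev rq, assumption?)+
  show thesis
  proof (rule that)
    show "m0 * q \<ge> 1" using m0(1) q(1) by simp
    show "\<mu> ^ m0 * \<nu> ^ m0 = 1" using q(2) by (metis power_mult_distrib power_one)
    have "\<bar>\<mu>\<bar> ^ m0 \<noteq> 1"
      using power_eq_imp_eq_base [of "\<bar>\<mu>\<bar>" m0 1] q(3) m0(1) by auto
    then show "\<bar>\<mu> ^ m0\<bar> \<noteq> 1" by (simp add: power_abs)
    show "x (j + m0 * q) = \<mu> ^ m0 * x j" "w (j + m0 * q) = \<nu> ^ m0 * w j" "r (j + m0 * q) = r j" for j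
      using all rq by blast+
  qed
qed

text \<open>At the end of a block the digit is at least 2, so \<open>x n >= l * x (Suc n)\<close>;
  \<open>\<phi>_Suc\<close> carries this back through the block.\<close>

lemma \<phi>_x_nonpos:
  assumes "hecke_digits p r"
  shows "hecke_digits.\<phi> p r x n \<le> 0"
proof -
  interpret hecke_digits p r by (rule assms)
  have sol: "sol x" by (simp add: sol_def rec)
  show ?thesis
  proof (induction "\<kappa> n" arbitrary: n)
    case 0
    then have r: "r n \<noteq> 1" using \<kappa>_Suc [of n] by auto
    then have "r n - 1 \<ge> 1" using r_ge_1 [of n] by linarith
    then have "1 * (l * x (Suc n)) \<le> of_int (r n - 1) * (l * x (Suc n))"
      using l_pos x_pos [of n] by (intro mult_right_mono) auto
    then have "l * x (Suc n) \<le> x n" using r_bounds(1) [of n] by linarith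
    then show ?case by (simp add: \<phi>_0 r)
  next
    case (Suc k)
    then have "r n = 1" using \<kappa>_0 [of n] by auto
    moreover from this have "k = \<kappa> (Suc n)" using Suc(2) \<kappa>_Suc [of n] by simp
    ultimately show ?case using Suc(1) [of "Suc n"] \<phi>_Suc [OF sol] by simp
  qed
qed

lemma R_w_iff:
  assumes "hecke_digits p r"
  shows "w 0 * hecke_digits.\<phi> p r w 0 > 0 \<longleftrightarrow>
    (\<exists>b. \<beta> = ereal b \<and> 0 < b \<and> s (Suc (hecke_digits.\<kappa> r 0)) * b < s (Suc (Suc (hecke_digits.\<kappa> r 0))))"
proof -
  interpret hecke_digits p r by (rule assms)
  note pos = s_\<kappa>_pos [of 0]
  show ?thesis
  proof (cases \<beta>)
    case (real b)
    have "0 < b * (s (Suc (Suc (\<kappa> 0))) - s (Suc (\<kappa> 0)) * b) \<longleftrightarrow>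
        0 < b \<and> s (Suc (\<kappa> 0)) * b < s (Suc (Suc (\<kappa> 0)))"
    \<comment> \<open>For negative \<open>b\<close> the other factor is positive, so the product can
      only be positive with both factors positive.\<close>
    proof (cases "b < 0")
      case True
      then have "s (Suc (\<kappa> 0)) * b < 0" using pos by (simp add: mult_pos_neg)
      then show ?thesis using True pos by (simp add: zero_less_mult_iff)
    qed (auto simp: zero_less_mult_iff)
    then show ?thesis unfolding \<phi>_def w_0 w_1 using real by simp
  next
    case PInf
    then show ?thesis unfolding \<phi>_def w_0 w_1 using pos by simp
  next
    case MInf
    then show ?thesis using pair by (simp add: hecke_pair_def is_pt_def)
  qed
qed

section \<open>The two implications\<close>

lemma reduced_imp_Ucond:
  assumes "Gp_reduced p \<alpha>" "leading_ones l \<alpha> k"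
  shows "k \<le> p - 3 \<and> Ucond p \<alpha> \<beta> k"
proof -
  obtain q \<mu> \<nu> where q: "q \<ge> 1" "\<mu> * \<nu> = 1" "\<bar>\<mu>\<bar> \<noteq> 1"
    and per: "\<And>j. x (j + q) = \<mu> * x j" "\<And>j. w (j + q) = \<nu> * w j" "\<And>j. r (j + q) = r j"
    by (rule reduced_imp_periodic [OF assms(1)]) blast
  have mu: "\<mu> \<noteq> 0" "\<nu> \<noteq> 0" "\<mu> \<noteq> 1" using q by auto
  have "\<mu> > 0" using per(1) [of 1] x_1 x_pos [of q] by simp
  obtain q' where q': "q = Suc q'" using q(1) by (metis Suc_le_D One_nat_def)
  \<comment> \<open>Periodicity identifies \<alpha> with a later complete quotient, which is
    positive and at least \<open>1 / l\<close>.\<close>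
  have "\<mu> * \<alpha> > 0" "\<mu> \<le> l * (\<mu> * \<alpha>)"
    using per(1) [of 0] per(1) [of 1] x_pos [of q'] x_Suc_Suc_le [of q'] x_0 x_1 q' by auto
  then have \<alpha>: "\<alpha> > 0" "1 \<le> l * \<alpha>"
    using \<open>\<mu> > 0\<close> by (auto simp: zero_less_mult_iff mult.left_commute [of l])
  then interpret hecke_digits p r by (rule digits)
  have sol: "sol x" "sol w" by (simp_all add: sol_def rec)
  have pos: "x n > 0" for n using x_pos [of "n - 1"] \<alpha> x_0 by (cases n) auto
  note le = \<phi>_x_nonpos [OF hecke_digits_axioms]
  have "0 < \<mu> \<and> \<mu> \<le> 1" by (rule multiplier_le_1 [OF sol(1) pos le per(1,3)])
  then have "\<mu> < 1" "0 < \<mu>" using mu by auto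
  then have "\<nu> > 1" using q(2) by (smt (verit) mult_less_cancel_left_pos mult_cancel_left2 mult_le_cancel_left_pos)
  moreover have "w 0 \<noteq> 0 \<or> w (Suc 0) \<noteq> 0" unfolding w_0 w_1 by (cases \<beta>) auto
  ultimately have Rw: "w 0 * \<phi> w 0 > 0"
    using R_or_multiplier_le_1 [OF sol(2) _ per(2,3) mu(2) q(1)] by auto
  have k: "\<kappa> 0 = k" using assms(2) by (intro \<kappa>_eqI) (auto simp: leading_ones_def)
  \<comment> \<open>With \<open>x 0 = \<alpha>\<close> and \<open>x 1 = 1\<close>, the signs of
    \<open>\<phi>\<close> and \<open>\<Phi>\<close> are the lower and upper bound on
    \<alpha>.\<close>
  have "\<phi> x 0 < 0" using \<phi>_nonzero [OF sol(1) pos le per(1,3) mu(3)] le [of 0] by simp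
  moreover have "\<Phi> x 0 > 0" by (rule \<Phi>_pos [OF sol(1) pos])
  ultimately have "s (Suc (Suc k)) < s (Suc k) * \<alpha>" "s k * \<alpha> < s (Suc k)"
    by (simp_all add: \<phi>_def \<Phi>_def k x_0 x_1)
  then show ?thesis
    using \<kappa>_le [of 0] Rw [unfolded R_w_iff [OF hecke_digits_axioms]] by (simp add: Ucond_iff k)
qed

lemma Ucond_imp_reduced:
  assumes k: "k \<le> p - 3" and U: "Ucond p \<alpha> \<beta> k"
  shows "Gp_reduced p \<alpha> \<and> leading_ones l \<alpha> k"
proof -
  have \<beta>: "\<exists>b. \<beta> = ereal b \<and> 0 < b \<and> s (Suc k) * b < s (Suc (Suc k))"
    and \<alpha>_gt: "s (Suc (Suc k)) < s (Suc k) * \<alpha>" and \<alpha>_less: "s k * \<alpha> < s (Suc k)"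
    using U k by (auto simp: Ucond_iff)
  have sk: "s (Suc k) > 0" using k p3 by (intro s_pos) auto
  \<comment> \<open>The value \<open>1 / l\<close> is the image of 0 under \<open>U^(p-1)\<close>,
    the lowest of the lower bounds for \<open>k <= p - 3\<close>.\<close>
  have "1 / l = s (Suc (p - 2)) / s (p - 2)"
    using s_p1 s_p2 p3 by (simp add: Suc_diff_le numeral_2_eq_2 Suc_diff_Suc)
  also have "\<dots> \<le> s (Suc (Suc k)) / s (Suc k)"
    using k p3 by (intro s_ratio_antimono) auto
  also have "\<dots> < \<alpha>" using \<alpha>_gt sk by (simp add: pos_divide_less_eq mult.commute)
  finally have "1 / l < \<alpha>" .
  then have \<alpha>: "\<alpha> > 0" "1 \<le> l * \<alpha>"
    using l_pos by (auto simp: pos_divide_less_eq mult.commute intro: less_trans [of 0 "1 / l"])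
  then interpret hecke_digits p r by (rule digits)
  have sol: "sol x" "sol w" by (simp_all add: sol_def rec)
  have pos: "x n > 0" for n using x_pos [of "n - 1"] \<alpha> x_0 by (cases n) auto
  \<comment> \<open>Both \<open>k\<close> and \<open>\<kappa> 0\<close> locate \<alpha> in one of
    the disjoint intervals, so they agree.\<close>
  have "s (Suc (Suc (\<kappa> 0))) \<le> s (Suc (\<kappa> 0)) * \<alpha>" "s (\<kappa> 0) * \<alpha> < s (Suc (\<kappa> 0))"
    using \<phi>_x_nonpos [OF hecke_digits_axioms, of 0] \<Phi>_pos [OF sol(1) pos, of 0]
    by (simp_all add: \<phi>_def \<Phi>_def x_0 x_1)
  then have \<kappa>: "\<kappa> 0 = k"
    using blocks_disjoint [of "\<kappa> 0" \<alpha> k] blocks_disjoint [of k \<alpha> "\<kappa> 0"] \<alpha>_gt \<alpha>_less k \<kappa>_le [of 0]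
    by simp
  have "w 0 * \<phi> w 0 > 0" using \<beta> by (simp add: R_w_iff [OF hecke_digits_axioms] \<kappa>)
  then have Rw: "w n * \<phi> w n > 0" for n using R_mono [OF sol(2)] by blast
  obtain m q \<mu> \<nu> where q: "q \<ge> 1" "\<mu> * \<nu> = 1" "\<bar>\<mu>\<bar> \<noteq> 1"
    and ev: "\<And>j. m \<le> j \<Longrightarrow> x (j + q) = \<mu> * x j \<and> w (j + q) = \<nu> * w j"
    by (rule eventually_periodic) blast
  have nu: "\<nu> \<noteq> 0" using q by auto
  \<comment> \<open>The factor \<open>\<nu>\<close> cancels in the quotients of \<open>w\<close>, so
    the digit one place earlier is forced.\<close>
  have digit: "r (j + q) = r j"
    if "\<And>i. j < i \<Longrightarrow> x (i + q) = \<mu> * x i \<and> w (i + q) = \<nu> * w i" for j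
    using that [of "Suc j"] that [of "Suc (Suc j)"] nu
    by (intro digit_determined_backwards [OF sol(2) Rw Rw]) simp
  have per: "x (j + q) = \<mu> * x j \<and> w (j + q) = \<nu> * w j" for j
    by (rule periodic_all [of m q \<mu> \<nu> j]) (fact ev, fact digit)
  have rper: "r (j + q) = r j" for j using per by (intro digit) auto
  \<comment> \<open>The excluded digits would keep \<open>\<phi> x\<close> constant, but a period
    multiplies this nonzero value by \<open>\<mu>\<close>.\<close>
  have "\<not> (\<forall>j. r j = (if j mod (p - 2) = 0 then 2 else 1))"
  proof
    assume "\<forall>j. r j = (if j mod (p - 2) = 0 then 2 else 1)"
    then have "\<phi> x (0 + q) = \<phi> x 0" by (intro \<phi>_const_if_parabolic_digits [OF sol(1)]) blast
    moreover have "\<phi> x (0 + q) = \<mu> * \<phi> x 0"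
      unfolding \<phi>_def \<kappa>_periodic [OF rper] using per [of 0] per [of 1] by (simp add: algebra_simps)
    moreover have "\<phi> x 0 \<noteq> 0" using \<alpha>_gt by (simp add: \<phi>_def \<kappa> x_0 x_1)
    ultimately show False using q(3) by simp
  qed
  then have "Gp_reduced p \<alpha>" unfolding Gp_reduced_def using q(1) rper by blast
  moreover have "leading_ones l \<alpha> k"
    using r_\<kappa> [of 0] r_less_\<kappa> [of _ 0] by (simp add: leading_ones_def \<kappa>)
  ultimately show ?thesis ..
qed

end

theorem theorem4p3:
  fixes p k :: nat and \<alpha> :: real and \<alpha>' :: ereal
  assumes "p \<ge> 3"
    and "hecke_pair p \<alpha> \<alpha>'"
  shows "(Gp_reduced p \<alpha> \<and> leading_ones (lam p) \<alpha> k) \<longleftrightarrow>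
         (Ucond p \<alpha> \<alpha>' k \<and> (\<forall>j<k. \<not> Ucond p \<alpha> \<alpha>' j))"
proof -
  interpret hecke_point p \<alpha> \<alpha>' by unfold_locales (rule assms)+
  show ?thesis
    unfolding Ucond_least_iff using reduced_imp_Ucond Ucond_imp_reduced by blast
qed

end
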